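(* Let $G$ be a finite abelian group acting without inversion on a finite graph $Y$, let $X=Y_G$, and let $O_X$ be an orientation of $X$. Then $$\chi_{\mathbb{C}[G]}(Y)=\sum_{v\in V_X}e_{G_v}-\sum_{s\in O_X}e_{G_s}.$$ In particular, if $G$ acts freely on $\mathbf{E}_Y$, then $\chi_{\mathbb{C}[G]}(Y)=\sum_{v\in V_X}e_{G_v}-|E_X|$.
   Context: Graphs in Serre's sense: vertex set $V_Y$, directed edges $\mathbf{E}_Y$, maps $o,t:\mathbf{E}_Y\to V_Y$, fixed-point-free involution $\varepsilon\mapsto\bar\varepsilon$ with $o(\bar\varepsilon)=t(\varepsilon)$; $E_Y$ is the set of undirected edges. $G$ acts without inversion if $\sigma\varepsilon\neq\bar\varepsilon$ for all $\sigma\in G,\varepsilon\in\mathbf{E}_Y$; then $Y_G$ is the quotient graph. Since $G$ is abelian, the stabilizer of a vertex (resp. directed edge) of $Y$ depends only on its image $v\in V_X$ (resp. $s\in\mathbf{E}_X$) and is denoted $G_v$ (resp. $G_s$). An orientation $O_X$ is a subset of $\mathbf{E}_X$ containing exactly one of $s,\bar s$ for each $s$. For $H\le G$, $e_H=\frac1{|H|}\sum_{h\in H}h\in\mathbb{C}[G]$. $C_0(Y)$ is the $\mathbb{C}$-vector space with basis $V_Y$, $C_1(Y)=\mathbb{C}\mathbf{E}_Y/W$ with $W$ spanned by the $\varepsilon+\bar\varepsilon$; both are $\mathbb{C}[G]$-modules. For a commutative ring $R$ and a finitely generated projective $R$-module $M$, $\mathrm{rank}_R(M)=\mathrm{tr}_R(\mathrm{id}_M)$,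 where for $f\in\mathrm{End}_R(M)$, $\mathrm{tr}_R(f)=\mathrm{tr}_R(f\oplus0_N)$ for any $N$ with $M\oplus N$ free of finite rank. The equivariant Euler characteristic is $\chi_{\mathbb{C}[G]}(Y)=\mathrm{rank}_{\mathbb{C}[G]}C_0(Y)-\mathrm{rank}_{\mathbb{C}[G]}C_1(Y)\in\mathbb{C}[G]$. *)

theory Defs
  imports Complex_Main "HOL-Algebra.Group_Action" "HOL-Algebra.Module" "HOL-Algebra.AbelCoset"
begin

section \<open>Graphs in the sense of Serre\<close>

record ('v, 'e) sgraph =
  verts :: "'v set"
  edges :: "'e set"
  org :: "'e \<Rightarrow> 'v"
  ter :: "'e \<Rightarrow> 'v"
  bar :: "'e \<Rightarrow> 'e"

locale serre_graph =
  fixes Y :: "('v, 'e) sgraph"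
  assumes org_closed: "e \<in> edges Y \<Longrightarrow> org Y e \<in> verts Y"
    and ter_closed: "e \<in> edges Y \<Longrightarrow> ter Y e \<in> verts Y"
    and bar_closed: "e \<in> edges Y \<Longrightarrow> bar Y e \<in> edges Y"
    and bar_bar: "e \<in> edges Y \<Longrightarrow> bar Y (bar Y e) = e"
    and bar_neq: "e \<in> edges Y \<Longrightarrow> bar Y e \<noteq> e"
    and org_bar: "e \<in> edges Y \<Longrightarrow> org Y (bar Y e) = ter Y e"

definition undirected_edges :: "('v, 'e) sgraph \<Rightarrow> 'e set set" where
  "undirected_edges Y = {{e, bar Y e} | e. e \<in> edges Y}"

definition orientation :: "('v, 'e) sgraph \<Rightarrow> 'e set \<Rightarrow> bool" where
  "orientation Y P \<longleftrightarrow> P \<subseteq> edges Y \<and> (\<forall>e\<in>edges Y. (e \<in> P) \<noteq> (bar Y e \<in> P))"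

locale finite_serre_graph = serre_graph +
  assumes finite_verts: "finite (verts Y)"
    and finite_edges: "finite (edges Y)"


section \<open>Group actions on graphs\<close>

locale graph_action =
  serre_graph Y + V: group_action G "verts Y" \<phi> + E: group_action G "edges Y" \<psi>
  for G :: "('g, 'm) monoid_scheme" (structure)
    and Y :: "('v, 'e) sgraph"
    and \<phi> :: "'g \<Rightarrow> 'v \<Rightarrow> 'v"
    and \<psi> :: "'g \<Rightarrow> 'e \<Rightarrow> 'e" +
  assumes org_act: "\<lbrakk>g \<in> carrier G; e \<in> edges Y\<rbrakk> \<Longrightarrow> org Y (\<psi> g e) = \<phi> g (org Y e)"
    and ter_act: "\<lbrakk>g \<in> carrier G; e \<in> edges Y\<rbrakk> \<Longrightarrow> ter Y (\<psi> g e) = \<phi> g (ter Y e)"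
    and bar_act: "\<lbrakk>g \<in> carrier G; e \<in> edges Y\<rbrakk> \<Longrightarrow> bar Y (\<psi> g e) = \<psi> g (bar Y e)"

locale graph_action_without_inversion = graph_action +
  assumes no_inversion: "\<lbrakk>g \<in> carrier G; e \<in> edges Y\<rbrakk> \<Longrightarrow> \<psi> g e \<noteq> bar Y e"

definition acts_freely_on ::
    "('g, 'm) monoid_scheme \<Rightarrow> ('g \<Rightarrow> 'b \<Rightarrow> 'b) \<Rightarrow> 'b set \<Rightarrow> bool" where
  "acts_freely_on G \<phi> S \<longleftrightarrow> (\<forall>g\<in>carrier G. \<forall>x\<in>S. \<phi> g x = x \<longrightarrow> g = \<one>\<^bsub>G\<^esub>)"

text \<open>
  The vertices and directed edges of the quotient graph are orbits. By equivariance, the image of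
  an edge orbit under \<^const>\<open>org\<close>, \<^const>\<open>ter\<close> or \<^const>\<open>bar\<close> is the orbit of the image of any
  of its members.
\<close>

definition quotient_graph ::
    "('g, 'm) monoid_scheme \<Rightarrow> ('v, 'e) sgraph \<Rightarrow> ('g \<Rightarrow> 'v \<Rightarrow> 'v) \<Rightarrow> ('g \<Rightarrow> 'e \<Rightarrow> 'e)
      \<Rightarrow> ('v set, 'e set) sgraph" where
  "quotient_graph G Y \<phi> \<psi> =
     \<lparr>verts = orbits G (verts Y) \<phi>, edges = orbits G (edges Y) \<psi>,
      org = (\<lambda>s. org Y ` s), ter = (\<lambda>s. ter Y ` s), bar = (\<lambda>s. bar Y ` s)\<rparr>"

lemma (in graph_action) image_orbit:
  assumes "e \<in> edges Y"
  shows "org Y ` orbit G \<psi> e = orbit G \<phi> (org Y e)"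
    and "ter Y ` orbit G \<psi> e = orbit G \<phi> (ter Y e)"
    and "bar Y ` orbit G \<psi> e = orbit G \<psi> (bar Y e)"
proof -
  have orbV: "orbit G \<theta> x = (\<lambda>g. \<theta> g x) ` carrier G" for \<theta> :: "'g \<Rightarrow> 'v \<Rightarrow> 'v" and x
    by (auto simp: orbit_def)
  have orbE: "orbit G \<theta> x = (\<lambda>g. \<theta> g x) ` carrier G" for \<theta> :: "'g \<Rightarrow> 'e \<Rightarrow> 'e" and x
    by (auto simp: orbit_def)
  show "org Y ` orbit G \<psi> e = orbit G \<phi> (org Y e)"
    unfolding orbV orbE image_image using assms by (auto simp: org_act intro!: image_cong)
  show "ter Y ` orbit G \<psi> e = orbit G \<phi> (ter Y e)"
    unfolding orbV orbE image_image using assms by (auto simp: ter_act intro!: image_cong)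
  show "bar Y ` orbit G \<psi> e = orbit G \<psi> (bar Y e)"
    unfolding orbE image_image using assms by (auto simp: bar_act intro!: image_cong)
qed

lemma (in graph_action_without_inversion) serre_graph_quotient:
  "serre_graph (quotient_graph G Y \<phi> \<psi>)"
proof
  fix s assume "s \<in> edges (quotient_graph G Y \<phi> \<psi>)"
  then obtain e where e: "e \<in> edges Y" and s: "s = orbit G \<psi> e"
    by (auto simp: quotient_graph_def orbits_def)
  show "org (quotient_graph G Y \<phi> \<psi>) s \<in> verts (quotient_graph G Y \<phi> \<psi>)"
    using e org_closed by (auto simp: quotient_graph_def orbits_def s image_orbit)
  show "ter (quotient_graph G Y \<phi> \<psi>) s \<in> verts (quotient_graph G Y \<phi> \<psi>)"
    using e ter_closed by (auto simp: quotient_graph_def orbits_def s image_orbit)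
  show "bar (quotient_graph G Y \<phi> \<psi>) s \<in> edges (quotient_graph G Y \<phi> \<psi>)"
    using e bar_closed by (auto simp: quotient_graph_def orbits_def s image_orbit)
  show "bar (quotient_graph G Y \<phi> \<psi>) (bar (quotient_graph G Y \<phi> \<psi>) s) = s"
    using e bar_closed by (simp add: quotient_graph_def s image_orbit bar_bar)
  show "org (quotient_graph G Y \<phi> \<psi>) (bar (quotient_graph G Y \<phi> \<psi>) s)
      = ter (quotient_graph G Y \<phi> \<psi>) s"
    using e bar_closed by (simp add: quotient_graph_def s image_orbit org_bar)
  have "bar Y e \<in> orbit G \<psi> (bar Y e)"
    using E.orbit_refl e bar_closed by blast
  moreover have "bar Y e \<notin> orbit G \<psi> e"
    using no_inversion e by (force simp: orbit_def)
  ultimately show "bar (quotient_graph G Y \<phi> \<psi>) s \<noteq> s"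
    using e by (auto simp: quotient_graph_def s image_orbit)
qed

text \<open>
  The common stabilizer of the members of an orbit; it exists when the group is abelian.
\<close>

definition orbit_stabilizer ::
    "('g, 'm) monoid_scheme \<Rightarrow> ('g \<Rightarrow> 'b \<Rightarrow> 'b) \<Rightarrow> 'b set \<Rightarrow> 'g set" where
  "orbit_stabilizer G \<phi> x = (THE H. \<forall>y\<in>x. stabilizer G \<phi> y = H)"

lemma (in group_action) orbit_stabilizer_eq:
  assumes "comm_group G" and "x \<in> E"
  shows "orbit_stabilizer G \<phi> (orbit G \<phi> x) = stabilizer G \<phi> x"
proof -
  interpret comm_group G by fact
  have "stabilizer G \<phi> y = stabilizer G \<phi> x" if y: "y \<in> orbit G \<phi> x" for y
  proof -
    obtain g where g: "g \<in> carrier G" "y = \<phi> g x"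
      using y by (auto simp: orbit_def)
    have "\<phi> h (\<phi> g x) = \<phi> g (\<phi> h x)" if "h \<in> carrier G" for h
      using that g assms by (metis composition_rule m_comm)
    moreover have "\<phi> g z = \<phi> g x \<longleftrightarrow> z = x" if "z \<in> E" for z
      using inj_prop[OF g(1)] that assms(2) by (auto simp: inj_on_def)
    ultimately show ?thesis
      using assms(2) element_image by (auto simp: stabilizer_def g(2))
  qed
  moreover have "x \<in> orbit G \<phi> x"
    using assms(2) by (rule orbit_refl)
  ultimately show ?thesis
    unfolding orbit_stabilizer_def by (intro the_equality) blast+
qed


section \<open>Trace and rank of finitely generated projective modules\<close>

text \<open>
  The fields \<^const>\<open>monoid.mult\<close> and \<^const>\<open>monoid.one\<close>, which a module record inherits from the
  ring record, play no role for modules.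
\<close>

definition direct_sum ::
    "('r, 'a, 'm) module_scheme \<Rightarrow> ('r, 'b, 'n) module_scheme \<Rightarrow> ('r, 'a \<times> 'b) module" where
  "direct_sum M N =
     \<lparr>carrier = carrier M \<times> carrier N, mult = undefined, one = undefined,
      zero = (\<zero>\<^bsub>M\<^esub>, \<zero>\<^bsub>N\<^esub>),
      add = (\<lambda>(x, y) (x', y'). (x \<oplus>\<^bsub>M\<^esub> x', y \<oplus>\<^bsub>N\<^esub> y')),
      smult = (\<lambda>a (x, y). (a \<odot>\<^bsub>M\<^esub> x, a \<odot>\<^bsub>N\<^esub> y))\<rparr>"

definition quotient_module ::
    "('r, 'a, 'm) module_scheme \<Rightarrow> 'a set \<Rightarrow> ('r, 'a set) module" where
  "quotient_module M W =
     \<lparr>carrier = a_rcosets\<^bsub>M\<^esub> W, mult = undefined, one = undefined,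
      zero = W,
      add = (\<lambda>X X'. X <+>\<^bsub>M\<^esub> X'),
      smult = (\<lambda>a X. \<Union>x\<in>X. W +>\<^bsub>M\<^esub> (a \<odot>\<^bsub>M\<^esub> x))\<rparr>"

definition is_coords ::
    "('r, 'k) ring_scheme \<Rightarrow> ('r, 'a, 'm) module_scheme \<Rightarrow> 'a set \<Rightarrow> 'a \<Rightarrow> ('a \<Rightarrow> 'r) \<Rightarrow> bool" where
  "is_coords R F B x c \<longleftrightarrow> c \<in> B \<rightarrow>\<^sub>E carrier R \<and> x = (\<Oplus>\<^bsub>F\<^esub>b\<in>B. c b \<odot>\<^bsub>F\<^esub> b)"

definition finite_basis ::
    "('r, 'k) ring_scheme \<Rightarrow> ('r, 'a, 'm) module_scheme \<Rightarrow> 'a set \<Rightarrow> bool" where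
  "finite_basis R F B \<longleftrightarrow>
     finite B \<and> B \<subseteq> carrier F \<and> (\<forall>x\<in>carrier F. \<exists>!c. is_coords R F B x c)"

definition basis_trace ::
    "('r, 'k) ring_scheme \<Rightarrow> ('r, 'a, 'm) module_scheme \<Rightarrow> 'a set \<Rightarrow> ('a \<Rightarrow> 'a) \<Rightarrow> 'r" where
  "basis_trace R F B f = (\<Oplus>\<^bsub>R\<^esub>b\<in>B. (THE c. is_coords R F B (f b) c) b)"

text \<open>
  The trace of an endomorphism \<open>f\<close> of \<open>M\<close> is the trace of \<open>f \<oplus> 0\<close> on \<open>M \<oplus> N\<close>, in any basis, for any
  module \<open>N\<close> such that \<open>M \<oplus> N\<close> is free of finite rank; such an \<open>N\<close> exists iff \<open>M\<close> is finitely
  generated and projective, and the value does not depend on the choices. A complement of \<open>M\<close> in a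
  free module of rank \<open>n\<close> is isomorphic to a submodule of \<open>R\<^sup>n\<close>, so no generality is lost
  by letting the elements of \<open>N\<close> be functions on the natural numbers with values in \<open>R\<close>.
\<close>

definition module_trace ::
    "('r, 'k) ring_scheme \<Rightarrow> ('r, 'a, 'm) module_scheme \<Rightarrow> ('a \<Rightarrow> 'a) \<Rightarrow> 'r" where
  "module_trace R M f =
     (THE t. \<exists>(N :: ('r, nat \<Rightarrow> 'r) module) B.
        Module.module R N \<and> finite_basis R (direct_sum M N) B \<and>
        t = basis_trace R (direct_sum M N) B (\<lambda>(x, y). (f x, \<zero>\<^bsub>N\<^esub>)))"

definition module_rank ::
    "('r, 'k) ring_scheme \<Rightarrow> ('r, 'a, 'm) module_scheme \<Rightarrow> 'r" where
  "module_rank R M = module_trace R M (\<lambda>x. x)"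


section \<open>Complex group rings and the chain modules of a graph\<close>

text \<open>
  For a finite set \<open>S\<close>, the complex vector space with basis \<open>S\<close> is the space of functions vanishing
  outside \<open>S\<close>: the function \<open>f\<close> stands for the formal sum of the \<open>f x \<cdot> x\<close>.
  The group \<open>G\<close> is meant to be finite as well.
\<close>

definition group_ring :: "('g, 'm) monoid_scheme \<Rightarrow> ('g \<Rightarrow> complex) ring" where
  "group_ring G =
     \<lparr>carrier = {a. \<forall>x. x \<notin> carrier G \<longrightarrow> a x = 0},
      mult = (\<lambda>a b x. \<Sum>(g, h) | g \<in> carrier G \<and> h \<in> carrier G \<and> g \<otimes>\<^bsub>G\<^esub> h = x. a g * b h),
      one = (\<lambda>x. if x = \<one>\<^bsub>G\<^esub> then 1 else 0),
      zero = (\<lambda>x. 0),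
      add = (\<lambda>a b x. a x + b x)\<rparr>"

definition permutation_module ::
    "('g, 'm) monoid_scheme \<Rightarrow> 'b set \<Rightarrow> ('g \<Rightarrow> 'b \<Rightarrow> 'b) \<Rightarrow> ('g \<Rightarrow> complex, 'b \<Rightarrow> complex) module" where
  "permutation_module G S \<phi> =
     \<lparr>carrier = {f. \<forall>x. x \<notin> S \<longrightarrow> f x = 0}, mult = undefined, one = undefined,
      zero = (\<lambda>x. 0),
      add = (\<lambda>f f' x. f x + f' x),
      smult = (\<lambda>a f x. \<Sum>(g, y) | g \<in> carrier G \<and> y \<in> S \<and> \<phi> g y = x. a g * f y)\<rparr>"

definition subgroup_idempotent :: "'g set \<Rightarrow> 'g \<Rightarrow> complex" where
  "subgroup_idempotent H = (\<lambda>x. if x \<in> H then 1 / of_nat (card H) else 0)"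

definition chain0 ::
    "('g, 'm) monoid_scheme \<Rightarrow> ('v, 'e) sgraph \<Rightarrow> ('g \<Rightarrow> 'v \<Rightarrow> 'v)
      \<Rightarrow> ('g \<Rightarrow> complex, 'v \<Rightarrow> complex) module" where
  "chain0 G Y \<phi> = permutation_module G (verts Y) \<phi>"

definition edge_relations :: "('v, 'e) sgraph \<Rightarrow> ('e \<Rightarrow> complex) set" where
  "edge_relations Y =
     {(\<lambda>x. \<Sum>e\<in>edges Y. c e * (of_bool (x = e) + of_bool (x = bar Y e))) | c. True}"

definition chain1 ::
    "('g, 'm) monoid_scheme \<Rightarrow> ('v, 'e) sgraph \<Rightarrow> ('g \<Rightarrow> 'e \<Rightarrow> 'e)
      \<Rightarrow> ('g \<Rightarrow> complex, ('e \<Rightarrow> complex) set) module" where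
  "chain1 G Y \<psi> = quotient_module (permutation_module G (edges Y) \<psi>) (edge_relations Y)"

definition equivariant_euler_char ::
    "('g, 'm) monoid_scheme \<Rightarrow> ('v, 'e) sgraph \<Rightarrow> ('g \<Rightarrow> 'v \<Rightarrow> 'v) \<Rightarrow> ('g \<Rightarrow> 'e \<Rightarrow> 'e)
      \<Rightarrow> 'g \<Rightarrow> complex" where
  "equivariant_euler_char G Y \<phi> \<psi> =
     module_rank (group_ring G) (chain0 G Y \<phi>)
       \<ominus>\<^bsub>group_ring G\<^esub> module_rank (group_ring G) (chain1 G Y \<psi>)"

end

theory Submission
  imports Defs
begin

text \<open>
  A dual basis of an \<open>R\<close>-module \<open>M\<close> is a finite family \<open>(x\<^sub>i, l\<^sub>i)\<close> of elements and linear forms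
  with \<open>m = \<Sum>\<^sub>i l\<^sub>i(m) x\<^sub>i\<close> for all \<open>m\<close>. A basis of \<open>M \<oplus> N\<close> projects to a dual basis of \<open>M\<close>, and the
  trace of \<open>id\<^sub>M \<oplus> 0\<close> becomes \<open>\<Sum>\<^sub>i l\<^sub>i(x\<^sub>i)\<close>, which is the same for all dual bases of \<open>M\<close> by expanding one
  in terms of the other. Hence a rank can be read off any dual basis.

  For \<open>C\<^sub>0(Y)\<close> take a vertex \<open>y\<close> in each orbit and the form
  \<open>f \<mapsto> |G\<^sub>y|\<^sup>-\<^sup>1 \<Sum>\<^sub>g f(g y) g\<close>, whose value at \<open>y\<close> is the idempotent of \<open>G\<^sub>y\<close>. For \<open>C\<^sub>1(Y)\<close> do the same with an edge
  \<open>\<epsilon>\<close> in each orbit of the orientation and \<open>f(g \<epsilon>)\<close> replaced by \<open>f(g \<epsilon>) - f(g \<epsilon>\<^sup>-)\<close>, where \<open>\<epsilon>\<^sup>-\<close> is the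
  reversed edge; this form kills the relations, and as there are no inversions its value at \<open>\<epsilon>\<close> is
  again the idempotent.
\<close>

section \<open>Dual bases and the rank of a module\<close>

definition linear_form ::
    "('r, 'k) ring_scheme \<Rightarrow> ('r, 'a, 'm) module_scheme \<Rightarrow> ('a \<Rightarrow> 'r) \<Rightarrow> bool" where
  "linear_form R M l \<longleftrightarrow> l \<in> carrier M \<rightarrow> carrier R \<and>
     (\<forall>x\<in>carrier M. \<forall>y\<in>carrier M. l (x \<oplus>\<^bsub>M\<^esub> y) = l x \<oplus>\<^bsub>R\<^esub> l y) \<and>
     (\<forall>a\<in>carrier R. \<forall>x\<in>carrier M. l (a \<odot>\<^bsub>M\<^esub> x) = a \<otimes>\<^bsub>R\<^esub> l x)"

text \<open>The elements form an indexed family rather than a set, because the projections to M of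
  distinct basis elements of a direct sum may coincide and each must still be counted.\<close>

definition dual_basis ::
    "('r, 'k) ring_scheme \<Rightarrow> ('r, 'a, 'm) module_scheme \<Rightarrow> 'i set \<Rightarrow> ('i \<Rightarrow> 'a) \<Rightarrow> ('i \<Rightarrow> 'a \<Rightarrow> 'r)
      \<Rightarrow> bool" where
  "dual_basis R M I x l \<longleftrightarrow> finite I \<and> x \<in> I \<rightarrow> carrier M \<and> (\<forall>i\<in>I. linear_form R M (l i)) \<and>
     (\<forall>m\<in>carrier M. m = (\<Oplus>\<^bsub>M\<^esub>i\<in>I. l i m \<odot>\<^bsub>M\<^esub> x i))"

lemma linear_formD:
  assumes "linear_form R M l"
  shows "x \<in> carrier M \<Longrightarrow> l x \<in> carrier R"
    and "\<lbrakk>x \<in> carrier M; y \<in> carrier M\<rbrakk> \<Longrightarrow> l (x \<oplus>\<^bsub>M\<^esub> y) = l x \<oplus>\<^bsub>R\<^esub> l y"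
    and "\<lbrakk>a \<in> carrier R; x \<in> carrier M\<rbrakk> \<Longrightarrow> l (a \<odot>\<^bsub>M\<^esub> x) = a \<otimes>\<^bsub>R\<^esub> l x"
  using assms by (auto simp: linear_form_def)

lemma dual_basisD:
  assumes "dual_basis R M I x l"
  shows "finite I"
    and "i \<in> I \<Longrightarrow> x i \<in> carrier M"
    and "i \<in> I \<Longrightarrow> linear_form R M (l i)"
    and "m \<in> carrier M \<Longrightarrow> (\<Oplus>\<^bsub>M\<^esub>i\<in>I. l i m \<odot>\<^bsub>M\<^esub> x i) = m"
  using assms by (auto simp: dual_basis_def)

lemma (in abelian_monoid) finsum_swap:
  assumes "finite A" "finite B" "\<And>i j. i \<in> A \<Longrightarrow> j \<in> B \<Longrightarrow> f i j \<in> carrier G"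
  shows "(\<Oplus>i\<in>A. \<Oplus>j\<in>B. f i j) = (\<Oplus>j\<in>B. \<Oplus>i\<in>A. f i j)"
  using assms(1,3)
proof (induction A rule: finite_induct)
  case empty
  then show ?case by simp
next
  case (insert a A)
  have "(\<Oplus>i\<in>insert a A. \<Oplus>j\<in>B. f i j) = (\<Oplus>j\<in>B. f a j) \<oplus> (\<Oplus>j\<in>B. \<Oplus>i\<in>A. f i j)"
    using insert by (subst finsum_insert) (auto intro!: finsum_closed)
  also have "\<dots> = (\<Oplus>j\<in>B. f a j \<oplus> (\<Oplus>i\<in>A. f i j))"
    using insert by (intro finsum_addf[symmetric]) (auto intro!: finsum_closed)
  also have "\<dots> = (\<Oplus>j\<in>B. \<Oplus>i\<in>insert a A. f i j)"
    using insert by (intro finsum_cong') (auto intro!: finsum_closed)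
  finally show ?case .
qed

section \<open>Linear forms and the trace of a dual basis\<close>

context module
begin

lemma linear_form_zero:
  assumes "linear_form R M l"
  shows "l \<zero>\<^bsub>M\<^esub> = \<zero>"
  using linear_formD(3)[OF assms, of \<zero> "\<zero>\<^bsub>M\<^esub>"] linear_formD(1)[OF assms, of "\<zero>\<^bsub>M\<^esub>"] by simp

lemma linear_form_finsum:
  assumes l: "linear_form R M l" and "finite I" "\<And>i. i \<in> I \<Longrightarrow> f i \<in> carrier M"
  shows "l (\<Oplus>\<^bsub>M\<^esub>i\<in>I. f i) = (\<Oplus>i\<in>I. l (f i))"
  using assms(2,3)
proof (induction I rule: finite_induct)
  case empty
  then show ?case using linear_form_zero[OF l] by simp
next
  case (insert a A)
  have "l (\<Oplus>\<^bsub>M\<^esub>i\<in>insert a A. f i) = l (f a) \<oplus> l (\<Oplus>\<^bsub>M\<^esub>i\<in>A. f i)"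
    using insert.prems insert.hyps by (simp add: linear_formD[OF l] Pi_iff)
  then show ?case
    using insert linear_formD(1)[OF l] by (simp add: Pi_iff)
qed

lemma linear_form_combination:
  assumes l: "linear_form R M l" and "finite I"
    and "\<And>i. i \<in> I \<Longrightarrow> c i \<in> carrier R" "\<And>i. i \<in> I \<Longrightarrow> x i \<in> carrier M"
  shows "l (\<Oplus>\<^bsub>M\<^esub>i\<in>I. c i \<odot>\<^bsub>M\<^esub> x i) = (\<Oplus>i\<in>I. c i \<otimes> l (x i))"
proof -
  have "l (\<Oplus>\<^bsub>M\<^esub>i\<in>I. c i \<odot>\<^bsub>M\<^esub> x i) = (\<Oplus>i\<in>I. l (c i \<odot>\<^bsub>M\<^esub> x i))"
    using assms by (intro linear_form_finsum) auto
  also have "\<dots> = (\<Oplus>i\<in>I. c i \<otimes> l (x i))"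
    using assms by (intro R.finsum_cong') (auto simp: linear_formD)
  finally show ?thesis .
qed

text \<open>Both sides equal the double sum of the products
  \<open>k j (x i) \<otimes> l i (y j)\<close>: expand \<open>x i\<close> in the family y before
  applying \<open>l i\<close>, and \<open>y j\<close> in the family x before applying
  \<open>k j\<close>. The two double sums agree because R is commutative.\<close>

lemma dual_basis_trace_unique:
  assumes x: "dual_basis R M I x l" and y: "dual_basis R M J y k"
  shows "(\<Oplus>i\<in>I. l i (x i)) = (\<Oplus>j\<in>J. k j (y j))"
proof -
  note xD = dual_basisD[OF x] and yD = dual_basisD[OF y]
  note cl [simp] = linear_formD(1)[OF xD(3)] linear_formD(1)[OF yD(3)]
  have "(\<Oplus>i\<in>I. l i (x i)) = (\<Oplus>i\<in>I. \<Oplus>j\<in>J. k j (x i) \<otimes> l i (y j))"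
  proof (rule R.finsum_cong')
    fix i assume i: "i \<in> I"
    have "l i (x i) = l i (\<Oplus>\<^bsub>M\<^esub>j\<in>J. k j (x i) \<odot>\<^bsub>M\<^esub> y j)"
      using yD(4) xD(2) i by simp
    also have "\<dots> = (\<Oplus>j\<in>J. k j (x i) \<otimes> l i (y j))"
      using i xD(1-3) yD(1,2) by (intro linear_form_combination) auto
    finally show "l i (x i) = (\<Oplus>j\<in>J. k j (x i) \<otimes> l i (y j))" .
  qed (use xD(1,2) yD(1,2) in \<open>auto intro!: R.finsum_closed\<close>)
  also have "\<dots> = (\<Oplus>j\<in>J. \<Oplus>i\<in>I. k j (x i) \<otimes> l i (y j))"
    using xD(1,2) yD(1,2) by (intro R.finsum_swap) auto
  also have "\<dots> = (\<Oplus>j\<in>J. k j (y j))"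
  proof (rule R.finsum_cong')
    fix j assume j: "j \<in> J"
    have "k j (y j) = k j (\<Oplus>\<^bsub>M\<^esub>i\<in>I. l i (y j) \<odot>\<^bsub>M\<^esub> x i)"
      using yD(2) xD(4) j by simp
    also have "\<dots> = (\<Oplus>i\<in>I. l i (y j) \<otimes> k j (x i))"
      using j xD(1,2) yD(1-3) by (intro linear_form_combination) auto
    also have "\<dots> = (\<Oplus>i\<in>I. k j (x i) \<otimes> l i (y j))"
      using j xD(1,2) yD(1,2) by (intro R.finsum_cong') (auto intro: R.m_comm)
    finally show "(\<Oplus>i\<in>I. k j (x i) \<otimes> l i (y j)) = k j (y j)" by simp
  qed (use xD(1,2) yD(1,2) in auto)
  finally show ?thesis .
qed

text \<open>This allows the index set to be an initial segment of the naturals, as required by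
  \<open>module_trace\<close>, whose complements consist of functions on \<open>nat\<close>.\<close>

lemma dual_basis_reindex:
  assumes "dual_basis R M I x l" and h: "bij_betw h J I"
  shows "dual_basis R M J (x \<circ> h) (l \<circ> h)"
proof -
  note D = dual_basisD[OF assms(1)]
  have I: "I = h ` J" "inj_on h J"
    using h by (auto simp: bij_betw_def)
  have fin: "finite J"
    using D(1) h bij_betw_finite by blast
  have "(\<Oplus>\<^bsub>M\<^esub>j\<in>J. l (h j) m \<odot>\<^bsub>M\<^esub> x (h j)) = m" if "m \<in> carrier M" for m
  proof -
    have "(\<Oplus>\<^bsub>M\<^esub>i\<in>h ` J. l i m \<odot>\<^bsub>M\<^esub> x i) = (\<Oplus>\<^bsub>M\<^esub>j\<in>J. l (h j) m \<odot>\<^bsub>M\<^esub> x (h j))"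
      using I D(2) that linear_formD(1)[OF D(3)] by (intro M.finsum_reindex) auto
    then show ?thesis
      using D(4)[OF that] I(1) by simp
  qed
  then show ?thesis
    using D(2,3) I fin by (auto simp: dual_basis_def)
qed

end

section \<open>Direct sums of modules\<close>

lemma direct_sum_sel [simp]:
  "carrier (direct_sum M N) = carrier M \<times> carrier N"
  "\<zero>\<^bsub>direct_sum M N\<^esub> = (\<zero>\<^bsub>M\<^esub>, \<zero>\<^bsub>N\<^esub>)"
  "(x, y) \<oplus>\<^bsub>direct_sum M N\<^esub> (x', y') = (x \<oplus>\<^bsub>M\<^esub> x', y \<oplus>\<^bsub>N\<^esub> y')"
  "a \<odot>\<^bsub>direct_sum M N\<^esub> (x, y) = (a \<odot>\<^bsub>M\<^esub> x, a \<odot>\<^bsub>N\<^esub> y)"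
  by (simp_all add: direct_sum_def)

lemma module_direct_sum:
  assumes "Module.module R M" "Module.module R N"
  shows "Module.module R (direct_sum M N)"
proof -
  interpret M: Module.module R M by fact
  interpret N: Module.module R N by fact
  show ?thesis
  proof (intro moduleI abelian_groupI)
    show "\<exists>y\<in>carrier (direct_sum M N). y \<oplus>\<^bsub>direct_sum M N\<^esub> x = \<zero>\<^bsub>direct_sum M N\<^esub>"
      if "x \<in> carrier (direct_sum M N)" for x
      using that by (intro bexI[of _ "(\<ominus>\<^bsub>M\<^esub> fst x, \<ominus>\<^bsub>N\<^esub> snd x)"])
        (auto simp: M.M.l_neg N.M.l_neg)
  qed (auto simp: M.M.a_ac N.M.a_ac M.smult_l_distr N.smult_l_distr
      M.smult_r_distr N.smult_r_distr M.smult_assoc1 N.smult_assoc1 M.R.is_cring)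
qed

lemma finsum_direct_sum:
  assumes "Module.module R M" "Module.module R N" "finite I"
    and "\<And>i. i \<in> I \<Longrightarrow> f i \<in> carrier M \<times> carrier N"
  shows "(\<Oplus>\<^bsub>direct_sum M N\<^esub>i\<in>I. f i) = (\<Oplus>\<^bsub>M\<^esub>i\<in>I. fst (f i), \<Oplus>\<^bsub>N\<^esub>i\<in>I. snd (f i))"
proof -
  interpret M: Module.module R M by fact
  interpret N: Module.module R N by fact
  interpret F: Module.module R "direct_sum M N" using assms by (intro module_direct_sum)
  have *: "fst (f i) \<in> carrier M" "snd (f i) \<in> carrier N" if "i \<in> I" for i
    using assms(4)[OF that] by auto
  show ?thesis
    using assms(3,4) *
  proof (induction I rule: finite_induct)
    case (insert a A)
    then have "(\<Oplus>\<^bsub>direct_sum M N\<^esub>i\<in>insert a A. f i) = f a \<oplus>\<^bsub>direct_sum M N\<^esub> (\<Oplus>\<^bsub>M\<^esub>i\<in>A. fst (f i), \<Oplus>\<^bsub>N\<^esub>i\<in>A. snd (f i))"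
      by (subst F.M.finsum_insert) auto
    also have "\<dots> = (fst (f a) \<oplus>\<^bsub>M\<^esub> (\<Oplus>\<^bsub>M\<^esub>i\<in>A. fst (f i)), snd (f a) \<oplus>\<^bsub>N\<^esub> (\<Oplus>\<^bsub>N\<^esub>i\<in>A. snd (f i)))"
      by (cases "f a") simp
    also have "\<dots> = (\<Oplus>\<^bsub>M\<^esub>i\<in>insert a A. fst (f i), \<Oplus>\<^bsub>N\<^esub>i\<in>insert a A. snd (f i))"
      using insert by (subst M.M.finsum_insert, auto)
    finally show ?case .
  qed simp
qed

section \<open>Coordinates in a finite basis\<close>

definition coord ::
    "('r, 'k) ring_scheme \<Rightarrow> ('r, 'a, 'm) module_scheme \<Rightarrow> 'a set \<Rightarrow> 'a \<Rightarrow> 'a \<Rightarrow> 'r" where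
  "coord R F B b x = (THE c. is_coords R F B x c) b"

context module
begin

text \<open>Coordinate functions are \<open>undefined\<close> off B, so the pointwise sum has to be
  restricted to B before uniqueness of coordinates can identify it with the coordinates of the
  sum.\<close>

lemma is_coords_add:
  assumes "finite B" "B \<subseteq> carrier M" "is_coords R M B x c" "is_coords R M B y d"
  shows "is_coords R M B (x \<oplus>\<^bsub>M\<^esub> y) (\<lambda>b\<in>B. c b \<oplus> d b)"
proof -
  have cd: "c b \<in> carrier R" "d b \<in> carrier R" if "b \<in> B" for b
    using assms that by (auto simp: is_coords_def)
  have "(\<Oplus>\<^bsub>M\<^esub>b\<in>B. (\<lambda>b\<in>B. c b \<oplus> d b) b \<odot>\<^bsub>M\<^esub> b) = (\<Oplus>\<^bsub>M\<^esub>b\<in>B. c b \<odot>\<^bsub>M\<^esub> b \<oplus>\<^bsub>M\<^esub> d b \<odot>\<^bsub>M\<^esub> b)"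
    using assms(2) cd by (intro M.finsum_cong') (auto simp: smult_l_distr subset_iff)
  also have "\<dots> = x \<oplus>\<^bsub>M\<^esub> y"
    using assms cd by (subst M.finsum_addf) (auto simp: is_coords_def)
  finally show ?thesis
    using cd by (auto simp: is_coords_def)
qed

lemma is_coords_smult:
  assumes "finite B" "B \<subseteq> carrier M" "is_coords R M B x c" "a \<in> carrier R"
  shows "is_coords R M B (a \<odot>\<^bsub>M\<^esub> x) (\<lambda>b\<in>B. a \<otimes> c b)"
proof -
  have c: "c b \<in> carrier R" if "b \<in> B" for b
    using assms that by (auto simp: is_coords_def)
  have "(\<Oplus>\<^bsub>M\<^esub>b\<in>B. (\<lambda>b\<in>B. a \<otimes> c b) b \<odot>\<^bsub>M\<^esub> b) = (\<Oplus>\<^bsub>M\<^esub>b\<in>B. a \<odot>\<^bsub>M\<^esub> (c b \<odot>\<^bsub>M\<^esub> b))"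
    using assms(2,4) c by (intro M.finsum_cong') (auto simp: smult_assoc1 subset_iff)
  also have "\<dots> = a \<odot>\<^bsub>M\<^esub> x"
    using assms c by (subst finsum_smult_ldistr[symmetric]) (auto simp: is_coords_def)
  finally show ?thesis
    using c assms(4) by (auto simp: is_coords_def)
qed

text \<open>Sums and multiples of coordinate functions are again coordinate functions, so their
  uniqueness makes each \<open>coord R M B b\<close> linear. The trace of this dual basis is the sum
  of diagonal entries that occurs in \<open>basis_trace\<close>.\<close>

lemma dual_basis_coord:
  assumes B: "finite_basis R M B"
  shows "dual_basis R M B (\<lambda>b. b) (coord R M B)"
proof -
  have fin: "finite B" "B \<subseteq> carrier M"
    using B by (auto simp: finite_basis_def)
  let ?c = "\<lambda>x. THE c. is_coords R M B x c"
  have c: "is_coords R M B x (?c x)" if "x \<in> carrier M" for x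
    by (rule theI'[of "is_coords R M B x"]) (use B that in \<open>simp add: finite_basis_def\<close>)
  have mem: "d b \<in> carrier R" if "is_coords R M B x d" "b \<in> B" for x d b
    using that by (auto simp: is_coords_def)
  have sum: "x = (\<Oplus>\<^bsub>M\<^esub>b\<in>B. d b \<odot>\<^bsub>M\<^esub> b)" if "is_coords R M B x d" for x d
    using that by (simp add: is_coords_def)
  have eq: "?c x = d" if "x \<in> carrier M" "is_coords R M B x d" for x d
    using B that c[OF that(1)] by (auto simp: finite_basis_def)
  have "linear_form R M (coord R M B b)" if b: "b \<in> B" for b
    unfolding linear_form_def
  proof (intro conjI ballI)
    show "coord R M B b \<in> carrier M \<rightarrow> carrier R"
      using mem[OF c b] by (simp add: coord_def)
    show "coord R M B b (x \<oplus>\<^bsub>M\<^esub> y) = coord R M B b x \<oplus> coord R M B b y"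
      if "x \<in> carrier M" "y \<in> carrier M" for x y
      using that b eq[OF _ is_coords_add[OF fin c c]] by (simp add: coord_def)
    show "coord R M B b (a \<odot>\<^bsub>M\<^esub> x) = a \<otimes> coord R M B b x"
      if "a \<in> carrier R" "x \<in> carrier M" for a x
      using that b eq[OF _ is_coords_smult[OF fin c]] by (simp add: coord_def)
  qed
  moreover have "x = (\<Oplus>\<^bsub>M\<^esub>b\<in>B. coord R M B b x \<odot>\<^bsub>M\<^esub> b)" if "x \<in> carrier M" for x
    using sum[OF c[OF that]] by (simp add: coord_def)
  ultimately show ?thesis
    using fin by (auto simp: dual_basis_def)
qed

end

text \<open>The expansion of (m, 0) in the direct sum is projected to its first component; the new
  forms are the old ones composed with the inclusion of M.\<close>

lemma dual_basis_of_summand: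
  assumes M: "Module.module R M" and N: "Module.module R N"
    and x: "dual_basis R (direct_sum M N) I x l"
  shows "dual_basis R M I (\<lambda>i. fst (x i)) (\<lambda>i m. l i (m, \<zero>\<^bsub>N\<^esub>))"
proof -
  interpret M: Module.module R M by fact
  interpret N: Module.module R N by fact
  note D = dual_basisD[OF x]
  have xc: "fst (x i) \<in> carrier M" "snd (x i) \<in> carrier N" if "i \<in> I" for i
    using D(2)[OF that] by auto
  have lf: "linear_form R M (\<lambda>m. l i (m, \<zero>\<^bsub>N\<^esub>))" if "i \<in> I" for i
    using linear_formD(1)[OF D(3)[OF that]] 
      linear_formD(2)[OF D(3)[OF that], of "(m, \<zero>\<^bsub>N\<^esub>)" "(m', \<zero>\<^bsub>N\<^esub>)" for m m']
      linear_formD(3)[OF D(3)[OF that], of _ "(m, \<zero>\<^bsub>N\<^esub>)" for m]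
    by (auto simp: linear_form_def)
  have "m = (\<Oplus>\<^bsub>M\<^esub>i\<in>I. l i (m, \<zero>\<^bsub>N\<^esub>) \<odot>\<^bsub>M\<^esub> fst (x i))" if m: "m \<in> carrier M" for m
  proof -
    have sm: "a \<odot>\<^bsub>direct_sum M N\<^esub> z = (a \<odot>\<^bsub>M\<^esub> fst z, a \<odot>\<^bsub>N\<^esub> snd z)" for a z
      by (cases z) simp
    have "(m, \<zero>\<^bsub>N\<^esub>) = (\<Oplus>\<^bsub>direct_sum M N\<^esub>i\<in>I. l i (m, \<zero>\<^bsub>N\<^esub>) \<odot>\<^bsub>direct_sum M N\<^esub> x i)"
      using D(4) m by simp
    also have "fst \<dots> = (\<Oplus>\<^bsub>M\<^esub>i\<in>I. l i (m, \<zero>\<^bsub>N\<^esub>) \<odot>\<^bsub>M\<^esub> fst (x i))"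
      using D(1) xc linear_formD(1)[OF lf] m by (subst finsum_direct_sum[OF M N]) (auto simp: sm)
    finally show ?thesis by simp
  qed
  then show ?thesis
    using D(1) xc lf by (auto simp: dual_basis_def)
qed

text \<open>The diagonal entry of the identity on M plus 0 on N at a basis element b is the b-th
  coordinate of (\<open>fst b\<close>, 0). The sum of these entries is thus the trace of the dual
  basis of M obtained by projecting B, and all dual bases of M have the same trace. In particular
  the value depends neither on N nor on B.\<close>

lemma basis_trace_complement:
  assumes M: "Module.module R M" and N: "Module.module R N"
    and B: "finite_basis R (direct_sum M N) B"
    and x: "dual_basis R M I x l"
  shows "basis_trace R (direct_sum M N) B (\<lambda>(m, n). (m, \<zero>\<^bsub>N\<^esub>)) = (\<Oplus>\<^bsub>R\<^esub>i\<in>I. l i (x i))"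
proof -
  interpret M: Module.module R M by fact
  interpret F: Module.module R "direct_sum M N" using M N by (rule module_direct_sum)
  let ?l = "\<lambda>b m. coord R (direct_sum M N) B b (m, \<zero>\<^bsub>N\<^esub>)"
  have "dual_basis R M B fst ?l"
    using dual_basis_of_summand[OF M N F.dual_basis_coord[OF B]] by simp
  from M.dual_basis_trace_unique[OF this x] show ?thesis
    by (simp add: basis_trace_def coord_def case_prod_beta)
qed

text \<open>This is the kernel of the map from \<open>R^I\<close> to M sending the i-th standard
  vector to \<open>x i\<close>. Its elements are functions from I to R, \<open>undefined\<close> off
  I, so that two of them are equal once they agree on I. For I a set of naturals they have the type
  demanded of a complement in \<open>module_trace\<close>.\<close>

definition relation_module ::
    "('r, 'k) ring_scheme \<Rightarrow> ('r, 'a, 'm) module_scheme \<Rightarrow> 'i set \<Rightarrow> ('i \<Rightarrow> 'a)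
      \<Rightarrow> ('r, 'i \<Rightarrow> 'r) module" where
  "relation_module R M I x =
     \<lparr>carrier = {c \<in> I \<rightarrow>\<^sub>E carrier R. (\<Oplus>\<^bsub>M\<^esub>i\<in>I. c i \<odot>\<^bsub>M\<^esub> x i) = \<zero>\<^bsub>M\<^esub>},
      mult = undefined, one = undefined,
      zero = (\<lambda>i\<in>I. \<zero>\<^bsub>R\<^esub>),
      add = (\<lambda>c d. \<lambda>i\<in>I. c i \<oplus>\<^bsub>R\<^esub> d i),
      smult = (\<lambda>a c. \<lambda>i\<in>I. a \<otimes>\<^bsub>R\<^esub> c i)\<rparr>"

lemma relation_module_sel [simp]:
  "c \<in> carrier (relation_module R M I x) \<longleftrightarrow>
     c \<in> I \<rightarrow>\<^sub>E carrier R \<and> (\<Oplus>\<^bsub>M\<^esub>i\<in>I. c i \<odot>\<^bsub>M\<^esub> x i) = \<zero>\<^bsub>M\<^esub>"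
  "\<zero>\<^bsub>relation_module R M I x\<^esub> = (\<lambda>i\<in>I. \<zero>\<^bsub>R\<^esub>)"
  "c \<oplus>\<^bsub>relation_module R M I x\<^esub> d = (\<lambda>i\<in>I. c i \<oplus>\<^bsub>R\<^esub> d i)"
  "a \<odot>\<^bsub>relation_module R M I x\<^esub> c = (\<lambda>i\<in>I. a \<otimes>\<^bsub>R\<^esub> c i)"
  by (simp_all add: relation_module_def)

context module
begin

lemma combination_add:
  assumes "finite I" "\<And>i. i \<in> I \<Longrightarrow> x i \<in> carrier M"
    and "\<And>i. i \<in> I \<Longrightarrow> c i \<in> carrier R" "\<And>i. i \<in> I \<Longrightarrow> d i \<in> carrier R"
  shows "(\<Oplus>\<^bsub>M\<^esub>i\<in>I. (c i \<oplus> d i) \<odot>\<^bsub>M\<^esub> x i)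
    = (\<Oplus>\<^bsub>M\<^esub>i\<in>I. c i \<odot>\<^bsub>M\<^esub> x i) \<oplus>\<^bsub>M\<^esub> (\<Oplus>\<^bsub>M\<^esub>i\<in>I. d i \<odot>\<^bsub>M\<^esub> x i)"
proof -
  have "(\<Oplus>\<^bsub>M\<^esub>i\<in>I. (c i \<oplus> d i) \<odot>\<^bsub>M\<^esub> x i) = (\<Oplus>\<^bsub>M\<^esub>i\<in>I. c i \<odot>\<^bsub>M\<^esub> x i \<oplus>\<^bsub>M\<^esub> d i \<odot>\<^bsub>M\<^esub> x i)"
    using assms by (intro M.finsum_cong') (auto simp: smult_l_distr)
  then show ?thesis
    using assms by (simp add: M.finsum_addf Pi_iff)
qed

lemma combination_smult:
  assumes "finite I" "\<And>i. i \<in> I \<Longrightarrow> x i \<in> carrier M"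
    and "\<And>i. i \<in> I \<Longrightarrow> c i \<in> carrier R" "a \<in> carrier R"
  shows "(\<Oplus>\<^bsub>M\<^esub>i\<in>I. (a \<otimes> c i) \<odot>\<^bsub>M\<^esub> x i) = a \<odot>\<^bsub>M\<^esub> (\<Oplus>\<^bsub>M\<^esub>i\<in>I. c i \<odot>\<^bsub>M\<^esub> x i)"
proof -
  have "(\<Oplus>\<^bsub>M\<^esub>i\<in>I. (a \<otimes> c i) \<odot>\<^bsub>M\<^esub> x i) = (\<Oplus>\<^bsub>M\<^esub>i\<in>I. a \<odot>\<^bsub>M\<^esub> (c i \<odot>\<^bsub>M\<^esub> x i))"
    using assms by (intro M.finsum_cong') (auto simp: smult_assoc1)
  then show ?thesis
    using assms by (simp add: finsum_smult_ldistr Pi_iff)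
qed

text \<open>The conditional is what simplification makes of the value at i of a function restricted
  to I.\<close>

lemma combination_restrict:
  assumes "\<And>i. i \<in> I \<Longrightarrow> x i \<in> carrier M" "\<And>i. i \<in> I \<Longrightarrow> c i \<in> carrier R"
  shows "(\<Oplus>\<^bsub>M\<^esub>i\<in>I. (if i \<in> I then c i else undefined) \<odot>\<^bsub>M\<^esub> x i) = (\<Oplus>\<^bsub>M\<^esub>i\<in>I. c i \<odot>\<^bsub>M\<^esub> x i)"
  using assms by (intro M.finsum_cong') auto

lemma combination_uminus:
  assumes "finite I" "\<And>i. i \<in> I \<Longrightarrow> x i \<in> carrier M" "\<And>i. i \<in> I \<Longrightarrow> c i \<in> carrier R"
  shows "(\<Oplus>\<^bsub>M\<^esub>i\<in>I. (\<ominus> c i) \<odot>\<^bsub>M\<^esub> x i) = \<ominus>\<^bsub>M\<^esub> (\<Oplus>\<^bsub>M\<^esub>i\<in>I. c i \<odot>\<^bsub>M\<^esub> x i)"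
proof -
  have "(\<Oplus>\<^bsub>M\<^esub>i\<in>I. (\<ominus> c i) \<odot>\<^bsub>M\<^esub> x i) = (\<Oplus>\<^bsub>M\<^esub>i\<in>I. (\<ominus> \<one> \<otimes> c i) \<odot>\<^bsub>M\<^esub> x i)"
    using assms by (intro M.finsum_cong') (auto simp: R.l_minus)
  also have "\<dots> = \<ominus>\<^bsub>M\<^esub> (\<Oplus>\<^bsub>M\<^esub>i\<in>I. c i \<odot>\<^bsub>M\<^esub> x i)"
    using assms by (subst combination_smult) (auto simp: smult_l_minus M.finsum_closed Pi_iff)
  finally show ?thesis .
qed

lemma combination_delta:
  assumes "finite I" "j \<in> I" "\<And>i. i \<in> I \<Longrightarrow> x i \<in> carrier M"
  shows "(\<Oplus>\<^bsub>M\<^esub>i\<in>I. (if i = j then \<one> else \<zero>) \<odot>\<^bsub>M\<^esub> x i) = x j"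
proof -
  have "(\<Oplus>\<^bsub>M\<^esub>i\<in>I. (if i = j then \<one> else \<zero>) \<odot>\<^bsub>M\<^esub> x i) = (\<Oplus>\<^bsub>M\<^esub>i\<in>I. if j = i then x i else \<zero>\<^bsub>M\<^esub>)"
    using assms by (intro M.finsum_cong') auto
  then show ?thesis
    using assms by (simp add: M.finsum_singleton Pi_iff)
qed

lemma module_relation_module:
  assumes I: "finite I" and x: "\<And>i. i \<in> I \<Longrightarrow> x i \<in> carrier M"
  shows "Module.module R (relation_module R M I x)" (is "Module.module R ?N")
proof -
  have [simp]: "c i \<in> carrier R" if "c \<in> I \<rightarrow>\<^sub>E carrier R" "i \<in> I" for c i
    using that by auto
  have [simp]: "c \<in> extensional I" if "c \<in> I \<rightarrow>\<^sub>E carrier R" for c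
    using that by (simp add: PiE_iff)
  show ?thesis
  proof (intro moduleI abelian_groupI)
    show "cring R"
      by (rule R.is_cring)
    show zero: "\<zero>\<^bsub>?N\<^esub> \<in> carrier ?N"
      using x by (simp add: combination_restrict M.finsum_closed cong: M.finsum_cong)
    show "c \<oplus>\<^bsub>?N\<^esub> d \<in> carrier ?N" if "c \<in> carrier ?N" "d \<in> carrier ?N" for c d
      using that I x by (auto simp: combination_restrict combination_add PiE_mem)
    show sm: "a \<odot>\<^bsub>?N\<^esub> c \<in> carrier ?N" if "a \<in> carrier R" "c \<in> carrier ?N" for a c
      using that I x by (auto simp: combination_restrict combination_smult PiE_mem)
    show "\<exists>d\<in>carrier ?N. d \<oplus>\<^bsub>?N\<^esub> c = \<zero>\<^bsub>?N\<^esub>" if "c \<in> carrier ?N" for c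
    proof
      \<comment> \<open>The additive inverse is taken to be (-1) c, so that closure under scalar
        multiplication shows that it is a relation.\<close>
      show "(\<ominus> \<one>) \<odot>\<^bsub>?N\<^esub> c \<in> carrier ?N"
        using that by (intro sm) auto
      show "(\<ominus> \<one>) \<odot>\<^bsub>?N\<^esub> c \<oplus>\<^bsub>?N\<^esub> c = \<zero>\<^bsub>?N\<^esub>"
        using that by (auto simp: R.l_minus PiE_mem R.l_neg intro!: restrict_ext)
    qed
  qed (auto simp: PiE_mem R.a_ac R.l_distr R.r_distr R.m_assoc extensional_restrict
        intro!: restrict_ext extensionalityI[of _ I])
qed

lemma finsum_relation_module:
  assumes I: "finite I" and x: "\<And>i. i \<in> I \<Longrightarrow> x i \<in> carrier M"
    and "finite J" "\<And>j. j \<in> J \<Longrightarrow> f j \<in> carrier (relation_module R M I x)"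
  shows "(\<Oplus>\<^bsub>relation_module R M I x\<^esub>j\<in>J. f j) = (\<lambda>i\<in>I. \<Oplus>j\<in>J. f j i)"
  using assms(3,4)
proof (induction J rule: finite_induct)
  interpret N: module R "relation_module R M I x"
    using I x by (rule module_relation_module)
  {
    case empty
    show ?case by simp
  next
    case (insert a A)
    have fR: "f j i \<in> carrier R" if "j \<in> insert a A" "i \<in> I" for i j
      using insert.prems[OF that(1)] that(2) by (auto simp: PiE_mem)
    have "(\<Oplus>\<^bsub>relation_module R M I x\<^esub>j\<in>insert a A. f j)
        = f a \<oplus>\<^bsub>relation_module R M I x\<^esub> (\<Oplus>\<^bsub>relation_module R M I x\<^esub>j\<in>A. f j)"
      using insert.hyps insert.prems
      by (intro N.M.finsum_insert) (auto simp del: relation_module_sel)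
    also have "\<dots> = (\<lambda>i\<in>I. \<Oplus>j\<in>insert a A. f j i)"
      using insert.IH insert.prems insert.hyps fR
      by (auto simp: Pi_iff simp del: relation_module_sel(1) intro!: restrict_ext)
    finally show ?case .
  }
qed

end

text \<open>
  \<open>M \<oplus> ker \<pi>\<close> is identified with \<open>R\<^sup>I\<close> through the section \<open>m \<mapsto> (l\<^sub>i m)\<^sub>i\<close> of
  \<open>\<pi> : R\<^sup>I \<rightarrow> M\<close>, \<open>e\<^sub>i \<mapsto> x\<^sub>i\<close>; the basis below corresponds to the standard basis.
\<close>

lemma (in module) finite_basis_relation_complement:
  assumes nontriv: "\<one> \<noteq> \<zero>" and dual: "dual_basis R M I x l"
  shows "\<exists>B. finite_basis R (direct_sum M (relation_module R M I x)) B"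
proof -
  note D = dual_basisD[OF dual]
  note [simp] = D(1,2) linear_formD(1)[OF D(3)]
  define N where "N = relation_module R M I x"
  define F where "F = direct_sum M N"
  define \<pi> where "\<pi> c = (\<Oplus>\<^bsub>M\<^esub>i\<in>I. c i \<odot>\<^bsub>M\<^esub> x i)" for c
  \<comment> \<open>The identification sends c to the pair of \<pi> c and c - (l_j(\<pi> c))_j. For
    c the i-th standard vector, \<pi> c is \<open>x i\<close>, which gives this formula.\<close>
  define b where "b i = (x i, \<lambda>j\<in>I. (if j = i then \<one> else \<zero>) \<ominus> l j (x i))" for i
  have N: "Module.module R N"
    unfolding N_def by (rule module_relation_module) auto
  interpret N: module R N by (rule N)
  interpret F: module R F
    unfolding F_def by (rule module_direct_sum) (use N module_axioms in auto)
  have bF: "b i \<in> carrier M \<times> carrier N" if i: "i \<in> I" for i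
  proof -
    \<comment> \<open>The second component is a relation: \<pi> sends the i-th standard vector to
      \<open>x i\<close>, and by the dual basis property it sends (l_j(x_i))_j to \<open>x i\<close>
      as well.\<close>
    have "\<pi> (\<lambda>j\<in>I. (if j = i then \<one> else \<zero>) \<ominus> l j (x i))
        = (\<Oplus>\<^bsub>M\<^esub>j\<in>I. ((if j = i then \<one> else \<zero>) \<oplus> \<ominus> l j (x i)) \<odot>\<^bsub>M\<^esub> x j)"
      using i by (simp add: \<pi>_def combination_restrict a_minus_def)
    also have "\<dots> = x i \<oplus>\<^bsub>M\<^esub> (\<ominus>\<^bsub>M\<^esub> x i)"
      using i by (simp add: combination_add combination_delta combination_uminus D(4))
    finally show ?thesis
      using i by (auto simp: b_def N_def \<pi>_def M.r_neg)
  qed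
  then have bF': "b i \<in> carrier F" if "i \<in> I" for i
    using that by (simp add: F_def)
  \<comment> \<open>The combination of the b_i with coefficients c is the image of c under the
    identification.\<close>
  have comb: "(\<Oplus>\<^bsub>F\<^esub>i\<in>I. c i \<odot>\<^bsub>F\<^esub> b i) = (\<pi> c, \<lambda>j\<in>I. c j \<ominus> l j (\<pi> c))"
    if "c \<in> I \<rightarrow> carrier R" for c
  proof -
    have c: "c i \<in> carrier R" if "i \<in> I" for i
      using \<open>c \<in> I \<rightarrow> carrier R\<close> that by auto
    have eq: "c i \<odot>\<^bsub>F\<^esub> b i = (c i \<odot>\<^bsub>M\<^esub> fst (b i), c i \<odot>\<^bsub>N\<^esub> snd (b i))" for i
      by (cases "b i") (simp add: F_def)
    have "(\<Oplus>\<^bsub>F\<^esub>i\<in>I. c i \<odot>\<^bsub>F\<^esub> b i) = (\<Oplus>\<^bsub>M\<^esub>i\<in>I. c i \<odot>\<^bsub>M\<^esub> x i, \<Oplus>\<^bsub>N\<^esub>i\<in>I. c i \<odot>\<^bsub>N\<^esub> snd (b i))"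
      unfolding F_def eq[unfolded F_def]
      by (subst finsum_direct_sum[OF module_axioms N]) (use bF c in \<open>auto simp: mem_Times_iff b_def\<close>)
    moreover have "(\<Oplus>\<^bsub>N\<^esub>i\<in>I. c i \<odot>\<^bsub>N\<^esub> snd (b i)) = (\<lambda>j\<in>I. \<Oplus>i\<in>I. (c i \<odot>\<^bsub>N\<^esub> snd (b i)) j)"
    proof -
      have "c i \<odot>\<^bsub>N\<^esub> snd (b i) \<in> carrier N" if "i \<in> I" for i
        using bF[OF that] c[OF that] by auto
      then show ?thesis
        unfolding N_def by (intro finsum_relation_module) auto
    qed
    moreover have "(\<Oplus>i\<in>I. (c i \<odot>\<^bsub>N\<^esub> snd (b i)) j) = c j \<ominus> l j (\<pi> c)" if j: "j \<in> I" for j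
    proof -
      have "(\<Oplus>i\<in>I. (c i \<odot>\<^bsub>N\<^esub> snd (b i)) j)
          = (\<Oplus>i\<in>I. (if j = i then c i else \<zero>) \<oplus> (\<ominus> \<one>) \<otimes> (c i \<otimes> l j (x i)))"
        using c j by (intro R.finsum_cong')
          (auto simp: N_def b_def a_minus_def R.r_distr R.r_minus R.l_minus)
      also have "\<dots> = c j \<oplus> (\<ominus> \<one>) \<otimes> (\<Oplus>i\<in>I. c i \<otimes> l j (x i))"
        using c j by (simp add: R.finsum_addf Pi_iff R.finsum_singleton R.finsum_rdistr)
      also have "\<dots> = c j \<ominus> l j (\<pi> c)"
        using c j D(3) by (simp add: \<pi>_def linear_form_combination a_minus_def R.l_minus R.finsum_closed Pi_iff)
      finally show ?thesis .
    qed
    ultimately show ?thesis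
      by (auto simp: \<pi>_def intro!: restrict_ext)
  qed
  have \<pi>_closed: "\<pi> c \<in> carrier M" if "c \<in> I \<rightarrow> carrier R" for c
    using that by (auto simp: \<pi>_def intro!: M.finsum_closed)
  \<comment> \<open>Equality of the first components gives \<pi> c = \<pi> d; then the terms
    l_j(\<pi> c) cancel in the second components.\<close>
  have inj: "c j = d j"
    if cd: "c \<in> I \<rightarrow> carrier R" "d \<in> I \<rightarrow> carrier R"
      and sums: "(\<Oplus>\<^bsub>F\<^esub>i\<in>I. c i \<odot>\<^bsub>F\<^esub> b i) = (\<Oplus>\<^bsub>F\<^esub>i\<in>I. d i \<odot>\<^bsub>F\<^esub> b i)" and j: "j \<in> I" for c d j
  proof -
    have eq: "(\<pi> c, \<lambda>j\<in>I. c j \<ominus> l j (\<pi> c)) = (\<pi> d, \<lambda>j\<in>I. d j \<ominus> l j (\<pi> d))"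
      using sums cd by (simp only: comb)
    then have "(\<lambda>j\<in>I. c j \<ominus> l j (\<pi> c)) = (\<lambda>j\<in>I. d j \<ominus> l j (\<pi> d))"
      by (elim Pair_inject)
    from fun_cong[OF this, of j] have "c j \<ominus> l j (\<pi> c) = d j \<ominus> l j (\<pi> c)"
      using j eq by simp
    moreover have "c j \<in> carrier R" "d j \<in> carrier R" "l j (\<pi> c) \<in> carrier R"
      using cd j \<pi>_closed[OF cd(1)] by auto
    ultimately show ?thesis
      by (simp add: a_minus_def)
  qed
  have binj: "inj_on b I"
  proof (rule inj_onI)
    fix i k assume ik: "i \<in> I" "k \<in> I" "b i = b k"
    have "(\<Oplus>\<^bsub>F\<^esub>j\<in>I. (if j = i then \<one> else \<zero>) \<odot>\<^bsub>F\<^esub> b j)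
        = (\<Oplus>\<^bsub>F\<^esub>j\<in>I. (if j = k then \<one> else \<zero>) \<odot>\<^bsub>F\<^esub> b j)"
      using ik bF' by (simp add: F.combination_delta)
    \<comment> \<open>Two unit vectors of coefficients give the same combination, so they agree at
      i; for i different from k this would say 1 = 0.\<close>
    then have "(if i = i then \<one> else \<zero>) = (if i = k then \<one> else \<zero>)"
      using ik(1) by (rule inj[rotated 2]) auto
    then show "i = k"
      using nontriv by (auto split: if_splits)
  qed
  have reindex: "(\<Oplus>\<^bsub>F\<^esub>e\<in>b ` I. c e \<odot>\<^bsub>F\<^esub> e) = (\<Oplus>\<^bsub>F\<^esub>i\<in>I. c (b i) \<odot>\<^bsub>F\<^esub> b i)"
    if "c \<in> b ` I \<rightarrow>\<^sub>E carrier R" for c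
    using that bF' binj by (intro F.M.finsum_reindex) (auto simp: Pi_iff PiE_iff simp del: split_paired_All)
  have "\<exists>!c. is_coords R F (b ` I) z c" if z: "z \<in> carrier F" for z
  proof -
    obtain m a where ma: "z = (m, a)" "m \<in> carrier M" "a \<in> carrier N"
      using z by (auto simp: F_def)
    have a: "a i \<in> carrier R" if "i \<in> I" for i
      using ma(3) that by (auto simp: N_def)
    \<comment> \<open>The preimage of (m, a) is a + (l_i(m))_i: here \<pi> kills the relation a and
      sends the second summand to m.\<close>
    define c where "c i = a i \<oplus> l i m" for i
    have c: "c i \<in> carrier R" if "i \<in> I" for i
      using that a ma(2) by (simp add: c_def)
    have \<pi>c: "\<pi> c = m"
      using a ma by (simp add: \<pi>_def c_def combination_add D(4) N_def)
    have "a \<in> extensional I"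
      using ma(3) by (simp add: N_def PiE_iff)
    then have "(\<lambda>j\<in>I. c j \<ominus> l j (\<pi> c)) = a"
      unfolding \<pi>c c_def using ma(2) a
      by (intro extensionalityI[of _ I]) (auto simp: a_minus_def R.a_assoc R.r_neg)
    with \<pi>c have zc: "z = (\<Oplus>\<^bsub>F\<^esub>i\<in>I. c i \<odot>\<^bsub>F\<^esub> b i)"
      using comb[of c] c ma by (simp add: Pi_iff)
    \<comment> \<open>Coordinates are indexed by basis elements, so c is carried over from I along
      the bijection b and made \<open>undefined\<close> off its image.\<close>
    define c' where "c' = (\<lambda>e\<in>b ` I. c (the_inv_into I b e))"
    have c': "c' (b i) = c i" if "i \<in> I" for i
      using that binj by (simp add: c'_def the_inv_into_f_f)
    have c'P: "c' \<in> b ` I \<rightarrow>\<^sub>E carrier R"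
      using c c' by (auto simp: c'_def the_inv_into_f_f[OF binj])
    have "(\<Oplus>\<^bsub>F\<^esub>i\<in>I. c' (b i) \<odot>\<^bsub>F\<^esub> b i) = z"
      unfolding zc using c c' bF' by (intro F.M.finsum_cong') auto
    then have c'coords: "is_coords R F (b ` I) z c'"
      using c'P by (simp add: is_coords_def reindex)
    moreover have "d = c'" if d: "is_coords R F (b ` I) z d" for d
    proof (rule PiE_ext)
      show dP: "d \<in> b ` I \<rightarrow>\<^sub>E carrier R"
        using d by (simp add: is_coords_def)
      show "c' \<in> b ` I \<rightarrow>\<^sub>E carrier R"
        by (rule c'P)
      fix e assume "e \<in> b ` I"
      then obtain j where j: "j \<in> I" "e = b j" by auto
      have "(\<Oplus>\<^bsub>F\<^esub>i\<in>I. d (b i) \<odot>\<^bsub>F\<^esub> b i) = z" "(\<Oplus>\<^bsub>F\<^esub>i\<in>I. c' (b i) \<odot>\<^bsub>F\<^esub> b i) = z"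
        using d c'coords reindex[OF dP] reindex[OF c'P] by (simp_all add: is_coords_def)
      then show "d e = c' e"
        unfolding j(2) using dP c'P j(1)
        by (intro inj[of "\<lambda>i. d (b i)" "\<lambda>i. c' (b i)" j]) (auto simp: PiE_iff simp del: split_paired_All)
    qed
    ultimately show ?thesis by blast
  qed
  then have "finite_basis R F (b ` I)"
    using bF' by (auto simp: finite_basis_def)
  then show ?thesis
    unfolding F_def N_def by blast
qed

text \<open>After renumbering by naturals, the relation module is an admissible complement, so the
  description in \<open>module_trace\<close> is satisfied by some value; by
  \<open>basis_trace_complement\<close> every admissible complement and basis give this same
  value.\<close>

theorem (in module) module_rank_eq_dual_basis_trace:
  assumes nontriv: "\<one> \<noteq> \<zero>" and dual: "dual_basis R M I x l"
  shows "module_rank R M = (\<Oplus>i\<in>I. l i (x i))"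
proof -
  obtain h where h: "bij_betw h {..<card I} I"
    using dual_basisD(1)[OF dual] by (metis ex_bij_betw_nat_finite lessThan_atLeast0)
  let ?N = "relation_module R M {..<card I} (x \<circ> h)"
  have dual': "dual_basis R M {..<card I} (x \<circ> h) (l \<circ> h)"
    using dual h by (rule dual_basis_reindex)
  obtain B where B: "finite_basis R (direct_sum M ?N) B"
    using finite_basis_relation_complement[OF nontriv dual'] by blast
  have N: "Module.module R ?N"
    using dual_basisD[OF dual'] by (intro module_relation_module) auto
  show ?thesis
    unfolding module_rank_def module_trace_def
  proof (rule the_equality)
    show "\<exists>(N :: ('a, nat \<Rightarrow> 'a) module) B. Module.module R N \<and> finite_basis R (direct_sum M N) B \<and>
        (\<Oplus>i\<in>I. l i (x i)) = basis_trace R (direct_sum M N) B (\<lambda>(x, y). (x, \<zero>\<^bsub>N\<^esub>))"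
      using B N basis_trace_complement[OF module_axioms N B dual, symmetric] by blast
  qed (auto simp: basis_trace_complement[OF module_axioms _ _ dual])
qed

section \<open>Quotient modules\<close>

lemma quotient_module_sel [simp]:
  "carrier (quotient_module M W) = a_rcosets\<^bsub>M\<^esub> W"
  "\<zero>\<^bsub>quotient_module M W\<^esub> = W"
  "X \<oplus>\<^bsub>quotient_module M W\<^esub> X' = X <+>\<^bsub>M\<^esub> X'"
  "a \<odot>\<^bsub>quotient_module M W\<^esub> X = (\<Union>x\<in>X. W +>\<^bsub>M\<^esub> (a \<odot>\<^bsub>M\<^esub> x))"
  by (simp_all add: quotient_module_def)

locale module_with_submodule = module R M for R (structure) and M (structure) +
  fixes W
  assumes submodule_W: "submodule W R M"
begin

sublocale W: abelian_subgroup W M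
  using submodule_W M.abelian_group_axioms
  by (intro abelian_subgroupI3 additive_subgroup.intro) (auto simp: submodule_def)

lemma rcosetsE:
  assumes "X \<in> a_rcosets\<^bsub>M\<^esub> W"
  obtains m where "m \<in> carrier M" "X = W +>\<^bsub>M\<^esub> m"
  using assms by (auto simp: A_RCOSETS_def')

lemma rcosetsI [simp]: "m \<in> carrier M \<Longrightarrow> W +>\<^bsub>M\<^esub> m \<in> a_rcosets\<^bsub>M\<^esub> W"
  by (auto simp: A_RCOSETS_def')

lemma mem_cosetE:
  assumes "y \<in> W +>\<^bsub>M\<^esub> m"
  obtains w where "w \<in> W" "y = w \<oplus>\<^bsub>M\<^esub> m"
  using assms by (auto simp: a_r_coset_def')

text \<open>Since W is closed under multiplication by a, all elements x of the coset of m give the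
  same coset of \<open>a x\<close>. The union in \<open>quotient_module\<close> is therefore a union
  of equal sets.\<close>

lemma smult_coset:
  assumes "a \<in> carrier R" "m \<in> carrier M"
  shows "(\<Union>x\<in>W +>\<^bsub>M\<^esub> m. W +>\<^bsub>M\<^esub> (a \<odot>\<^bsub>M\<^esub> x)) = W +>\<^bsub>M\<^esub> (a \<odot>\<^bsub>M\<^esub> m)"
proof -
  have "W +>\<^bsub>M\<^esub> (a \<odot>\<^bsub>M\<^esub> x) = W +>\<^bsub>M\<^esub> (a \<odot>\<^bsub>M\<^esub> m)" if "x \<in> W +>\<^bsub>M\<^esub> m" for x
  proof -
    obtain w where w: "w \<in> W" "x = w \<oplus>\<^bsub>M\<^esub> m"
      using \<open>x \<in> W +>\<^bsub>M\<^esub> m\<close> by (rule mem_cosetE)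
    have "a \<odot>\<^bsub>M\<^esub> x = a \<odot>\<^bsub>M\<^esub> w \<oplus>\<^bsub>M\<^esub> a \<odot>\<^bsub>M\<^esub> m"
      using assms w by (simp add: smult_r_distr)
    moreover have "a \<odot>\<^bsub>M\<^esub> w \<in> W"
      using submodule_W assms(1) w(1) by (rule submodule.smult_closed)
    ultimately have "a \<odot>\<^bsub>M\<^esub> x \<in> W +>\<^bsub>M\<^esub> (a \<odot>\<^bsub>M\<^esub> m)"
      by (auto simp: a_r_coset_def')
    then show ?thesis
      using assms by (intro W.a_repr_independence'[symmetric]) auto
  qed
  then show ?thesis
    using W.a_rcos_self[OF assms(2)] by blast
qed

lemma module_quotient: "Module.module R (quotient_module M W)" (is "Module.module R ?Q")
proof -
  have zero: "W +>\<^bsub>M\<^esub> \<zero>\<^bsub>M\<^esub> = W"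
    by (rule W.a_rcos_const) simp
  note add = W.a_rcos_sum
  have smult: "a \<odot>\<^bsub>?Q\<^esub> (W +>\<^bsub>M\<^esub> m) = W +>\<^bsub>M\<^esub> (a \<odot>\<^bsub>M\<^esub> m)" if "a \<in> carrier R" "m \<in> carrier M" for a m
    using that by (simp add: smult_coset)
  show ?thesis
  proof (intro moduleI abelian_groupI)
    show "cring R"
      by (rule R.is_cring)
    show "\<zero>\<^bsub>?Q\<^esub> \<in> carrier ?Q"
      using rcosetsI[of "\<zero>\<^bsub>M\<^esub>"] by (simp add: zero)
    show "\<zero>\<^bsub>?Q\<^esub> \<oplus>\<^bsub>?Q\<^esub> X = X" if "X \<in> carrier ?Q" for X
      using that by (simp add: W.rcosets_add_eq)
    show "\<exists>Z\<in>carrier ?Q. Z \<oplus>\<^bsub>?Q\<^esub> X = \<zero>\<^bsub>?Q\<^esub>" if X: "X \<in> carrier ?Q" for X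
    proof -
      obtain m where "m \<in> carrier M" "X = W +>\<^bsub>M\<^esub> m"
        using X by (auto elim: rcosetsE)
      then show ?thesis
        by (intro bexI[of _ "W +>\<^bsub>M\<^esub> (\<ominus>\<^bsub>M\<^esub> m)"]) (simp_all add: add M.l_neg zero)
    qed
    show "X \<oplus>\<^bsub>?Q\<^esub> Z = Z \<oplus>\<^bsub>?Q\<^esub> X" if XZ: "X \<in> carrier ?Q" "Z \<in> carrier ?Q" for X Z
    proof -
      obtain m n where "m \<in> carrier M" "X = W +>\<^bsub>M\<^esub> m" "n \<in> carrier M" "Z = W +>\<^bsub>M\<^esub> n"
        using XZ by (auto elim!: rcosetsE)
      then show ?thesis
        by (simp add: add M.a_comm)
    qed
  qed (auto simp: add smult M.a_assoc smult_l_distr smult_r_distr smult_assoc1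
      simp del: quotient_module_sel(4) elim!: rcosetsE)
qed

lemma finsum_quotient:
  assumes "finite I" "\<And>i. i \<in> I \<Longrightarrow> f i \<in> carrier M"
  shows "(\<Oplus>\<^bsub>quotient_module M W\<^esub>i\<in>I. W +>\<^bsub>M\<^esub> f i) = W +>\<^bsub>M\<^esub> (\<Oplus>\<^bsub>M\<^esub>i\<in>I. f i)"
proof -
  interpret Q: module R "quotient_module M W"
    by (rule module_quotient)
  show ?thesis
    using assms
  proof (induction I rule: finite_induct)
    case empty
    then show ?case by (simp add: W.a_rcos_const)
  next
    case (insert a A)
    then show ?case
      by (subst Q.finsum_insert) (auto simp: W.a_rcos_sum)
  qed
qed

text \<open>Forms that kill W descend to the quotient. The expansion is asked only modulo W: in the
  application to edges, a chain is recovered from the forms only up to relations.\<close>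

lemma dual_basis_quotient:
  assumes fin: "finite I" and x: "\<And>i. i \<in> I \<Longrightarrow> x i \<in> carrier M"
    and l: "\<And>i. i \<in> I \<Longrightarrow> linear_form R M (l i)"
    and l0: "\<And>i w. i \<in> I \<Longrightarrow> w \<in> W \<Longrightarrow> l i w = \<zero>"
    and sum: "\<And>m. m \<in> carrier M \<Longrightarrow> m \<in> W +>\<^bsub>M\<^esub> (\<Oplus>\<^bsub>M\<^esub>i\<in>I. l i m \<odot>\<^bsub>M\<^esub> x i)"
  obtains k where "dual_basis R (quotient_module M W) I (\<lambda>i. W +>\<^bsub>M\<^esub> x i) k"
    and "\<And>i m. i \<in> I \<Longrightarrow> m \<in> carrier M \<Longrightarrow> k i (W +>\<^bsub>M\<^esub> m) = l i m"
proof -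
  note lD = linear_formD[OF l]
  \<comment> \<open>The form is constant on each coset because it kills W, so its image of a coset
    is a singleton.\<close>
  define k where "k i X = the_elem (l i ` X)" for i X
  have k: "k i (W +>\<^bsub>M\<^esub> m) = l i m" if im: "i \<in> I" "m \<in> carrier M" for i m
  proof -
    have "l i y = l i m" if "y \<in> W +>\<^bsub>M\<^esub> m" for y
    proof -
      obtain w where w: "w \<in> W" "y = w \<oplus>\<^bsub>M\<^esub> m"
        using \<open>y \<in> W +>\<^bsub>M\<^esub> m\<close> by (rule mem_cosetE)
      then show ?thesis
        using im l0[of i w] by (simp add: lD)
    qed
    then have "l i ` (W +>\<^bsub>M\<^esub> m) = {l i m}"
      using W.a_rcos_self[OF im(2)] by blast
    then show ?thesis by (simp add: k_def)
  qed
  have "linear_form R (quotient_module M W) (k i)" if "i \<in> I" for i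
    using that by (auto simp: linear_form_def k lD W.a_rcos_sum smult_coset elim!: rcosetsE)
  moreover have "X = (\<Oplus>\<^bsub>quotient_module M W\<^esub>i\<in>I. k i X \<odot>\<^bsub>quotient_module M W\<^esub> (W +>\<^bsub>M\<^esub> x i))"
    if "X \<in> a_rcosets\<^bsub>M\<^esub> W" for X
  proof -
    interpret Q: module R "quotient_module M W"
      by (rule module_quotient)
    obtain m where m: "m \<in> carrier M" "X = W +>\<^bsub>M\<^esub> m"
      using \<open>X \<in> _\<close> by (rule rcosetsE)
    have "(\<Oplus>\<^bsub>quotient_module M W\<^esub>i\<in>I. k i X \<odot>\<^bsub>quotient_module M W\<^esub> (W +>\<^bsub>M\<^esub> x i))
        = (\<Oplus>\<^bsub>quotient_module M W\<^esub>i\<in>I. W +>\<^bsub>M\<^esub> (l i m \<odot>\<^bsub>M\<^esub> x i))"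
      using m x by (intro Q.finsum_cong') (auto simp: k lD smult_coset)
    also have "\<dots> = W +>\<^bsub>M\<^esub> (\<Oplus>\<^bsub>M\<^esub>i\<in>I. l i m \<odot>\<^bsub>M\<^esub> x i)"
      using fin x m by (intro finsum_quotient) (auto simp: lD)
    also have "\<dots> = X"
      unfolding m(2) using sum[OF m(1)] m(1) x
      by (intro W.a_repr_independence' M.finsum_closed) (auto simp: lD)
    finally show ?thesis by simp
  qed
  ultimately have "dual_basis R (quotient_module M W) I (\<lambda>i. W +>\<^bsub>M\<^esub> x i) k"
    using fin x by (auto simp: dual_basis_def simp del: quotient_module_sel(4))
  then show thesis
    using that k by blast
qed

end

section \<open>Permutation modules over the group ring\<close>

lemma group_ring_sel [simp]:
  "a \<in> carrier (group_ring G) \<longleftrightarrow> (\<forall>x. x \<notin> carrier G \<longrightarrow> a x = 0)"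
  "\<one>\<^bsub>group_ring G\<^esub> = (\<lambda>x. if x = \<one>\<^bsub>G\<^esub> then 1 else 0)"
  "\<zero>\<^bsub>group_ring G\<^esub> = (\<lambda>x. 0)"
  "a \<oplus>\<^bsub>group_ring G\<^esub> b = (\<lambda>x. a x + b x)"
  by (simp_all add: group_ring_def)

lemma permutation_module_sel [simp]:
  "f \<in> carrier (permutation_module G S \<phi>) \<longleftrightarrow> (\<forall>x. x \<notin> S \<longrightarrow> f x = 0)"
  "\<zero>\<^bsub>permutation_module G S \<phi>\<^esub> = (\<lambda>x. 0)"
  "f \<oplus>\<^bsub>permutation_module G S \<phi>\<^esub> f' = (\<lambda>x. f x + f' x)"
  by (simp_all add: permutation_module_def)

lemma abelian_group_group_ring: "abelian_group (group_ring G)"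
proof (rule abelian_groupI)
  show "\<exists>b\<in>carrier (group_ring G). b \<oplus>\<^bsub>group_ring G\<^esub> a = \<zero>\<^bsub>group_ring G\<^esub>"
    if "a \<in> carrier (group_ring G)" for a
    using that by (intro bexI[of _ "\<lambda>x. - a x"]) auto
qed (auto simp: algebra_simps)

lemma abelian_group_permutation_module: "abelian_group (permutation_module G S \<phi>)"
proof (rule abelian_groupI)
  show "\<exists>b\<in>carrier (permutation_module G S \<phi>).
      b \<oplus>\<^bsub>permutation_module G S \<phi>\<^esub> a = \<zero>\<^bsub>permutation_module G S \<phi>\<^esub>"
    if "a \<in> carrier (permutation_module G S \<phi>)" for a
    using that by (intro bexI[of _ "\<lambda>x. - a x"]) auto
qed (auto simp: algebra_simps)

lemma finsum_permutation_module:
  assumes "finite I" "\<And>i. i \<in> I \<Longrightarrow> f i \<in> carrier (permutation_module G S \<phi>)"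
  shows "(\<Oplus>\<^bsub>permutation_module G S \<phi>\<^esub>i\<in>I. f i) = (\<lambda>x. \<Sum>i\<in>I. f i x)"
proof -
  interpret abelian_group "permutation_module G S \<phi>" by (rule abelian_group_permutation_module)
  show ?thesis
    using assms
  proof (induction I rule: finite_induct)
    case (insert i I)
    then show ?case
      by (subst finsum_insert) (auto simp del: permutation_module_sel(1))
  qed simp
qed

locale finite_comm_group = comm_group G for G (structure) +
  assumes finite_carrier [simp]: "finite (carrier G)"
begin

text \<open>Pairs with product x are parametrized by their first factor g, the second being
  \<open>inv g \<otimes> x\<close>. As a sum over the fixed set \<open>carrier G\<close>, the
  product is open to exchange of sums and translation.\<close>

lemma group_ring_mult:
  "a \<otimes>\<^bsub>group_ring G\<^esub> b =
     (\<lambda>x. if x \<in> carrier G then \<Sum>g\<in>carrier G. a g * b (inv g \<otimes> x) else 0)"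
proof
  fix x
  let ?A = "{(g, h). g \<in> carrier G \<and> h \<in> carrier G \<and> g \<otimes> h = x}"
  have eq: "(a \<otimes>\<^bsub>group_ring G\<^esub> b) x = (\<Sum>(g, h)\<in>?A. a g * b h)"
    by (simp add: group_ring_def)
  show "(a \<otimes>\<^bsub>group_ring G\<^esub> b) x = (if x \<in> carrier G then \<Sum>g\<in>carrier G. a g * b (inv g \<otimes> x) else 0)"
  proof (cases "x \<in> carrier G")
    case True
    have "(\<Sum>(g, h)\<in>?A. a g * b h) = (\<Sum>g\<in>carrier G. a g * b (inv g \<otimes> x))"
      by (rule sum.reindex_bij_witness[of _ "\<lambda>g. (g, inv g \<otimes> x)" fst])
        (use True in \<open>auto simp: inv_solve_left m_assoc[symmetric]\<close>)
    with True eq show ?thesis by simp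
  next
    case False
    then have "?A = {}" by auto
    with False eq show ?thesis by simp
  qed
qed

lemma sum_mult_left:
  assumes "h \<in> carrier G"
  shows "(\<Sum>g\<in>carrier G. F g) = (\<Sum>g\<in>carrier G. F (h \<otimes> g))"
  by (rule sum.reindex_bij_witness[of _ "\<lambda>g. h \<otimes> g" "\<lambda>g. inv h \<otimes> g"])
    (use assms in \<open>auto simp: m_assoc[symmetric]\<close>)

lemma cring_group_ring: "cring (group_ring G)"
proof (rule cringI)
  let ?R = "group_ring G"
  show "abelian_group ?R"
    by (rule abelian_group_group_ring)
  show "comm_monoid ?R"
  proof (rule comm_monoidI)
    fix a b c
    assume "a \<in> carrier ?R" "b \<in> carrier ?R" "c \<in> carrier ?R"
    show "a \<otimes>\<^bsub>?R\<^esub> b \<otimes>\<^bsub>?R\<^esub> c = a \<otimes>\<^bsub>?R\<^esub> (b \<otimes>\<^bsub>?R\<^esub> c)"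
    proof
      fix x
      show "(a \<otimes>\<^bsub>?R\<^esub> b \<otimes>\<^bsub>?R\<^esub> c) x = (a \<otimes>\<^bsub>?R\<^esub> (b \<otimes>\<^bsub>?R\<^esub> c)) x"
      proof (cases "x \<in> carrier G")
        case True
        have "(a \<otimes>\<^bsub>?R\<^esub> b \<otimes>\<^bsub>?R\<^esub> c) x
            = (\<Sum>g\<in>carrier G. \<Sum>h\<in>carrier G. a h * b (inv h \<otimes> g) * c (inv g \<otimes> x))"
          using True by (simp add: group_ring_mult sum_distrib_right)
        also have "\<dots> = (\<Sum>h\<in>carrier G. \<Sum>g\<in>carrier G. a h * b (inv h \<otimes> g) * c (inv g \<otimes> x))"
          by (rule sum.swap)
        \<comment> \<open>For fixed h the variable g is replaced by h g, which turns the argument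
          \<open>inv h \<otimes> g\<close> of b into g.\<close>
        also have "\<dots> = (\<Sum>h\<in>carrier G. \<Sum>g\<in>carrier G.
            a h * b (inv h \<otimes> (h \<otimes> g)) * c (inv (h \<otimes> g) \<otimes> x))"
          by (rule sum.cong[OF refl], rule sum_mult_left)
        also have "\<dots> = (\<Sum>h\<in>carrier G. \<Sum>g\<in>carrier G. a h * (b g * c (inv g \<otimes> (inv h \<otimes> x))))"
          using True by (intro sum.cong refl) (simp add: m_assoc[symmetric] inv_mult_group)
        also have "\<dots> = (a \<otimes>\<^bsub>?R\<^esub> (b \<otimes>\<^bsub>?R\<^esub> c)) x"
          using True by (simp add: group_ring_mult sum_distrib_left)
        finally show ?thesis .
      qed (simp add: group_ring_mult)
    qed
  next
    fix a b :: "'a \<Rightarrow> complex"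
    \<comment> \<open>Commutativity is read off the sum over pairs by exchanging the two factors, G
      being abelian.\<close>
    have "(\<Sum>(g, h) | g \<in> carrier G \<and> h \<in> carrier G \<and> g \<otimes> h = x. a g * b h)
        = (\<Sum>(g, h) | g \<in> carrier G \<and> h \<in> carrier G \<and> g \<otimes> h = x. b g * a h)" for x
      by (rule sum.reindex_bij_witness[of _ prod.swap prod.swap]) (auto simp: m_comm mult.commute)
    then show "a \<otimes>\<^bsub>?R\<^esub> b = b \<otimes>\<^bsub>?R\<^esub> a"
      by (simp add: group_ring_def)
  next
    fix a assume a: "a \<in> carrier ?R"
    have "(\<Sum>g\<in>carrier G. (if g = \<one> then 1 else 0) * a (inv g \<otimes> x)) = a x" if "x \<in> carrier G" for x
      using that by (simp add: if_distrib[of "\<lambda>c. c * _"] sum.delta cong: if_cong)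
    then show "\<one>\<^bsub>?R\<^esub> \<otimes>\<^bsub>?R\<^esub> a = a"
      using a by (auto simp: group_ring_mult)
  qed (auto simp: group_ring_mult)
  show "(a \<oplus>\<^bsub>?R\<^esub> b) \<otimes>\<^bsub>?R\<^esub> c = a \<otimes>\<^bsub>?R\<^esub> c \<oplus>\<^bsub>?R\<^esub> b \<otimes>\<^bsub>?R\<^esub> c" for a b c
    by (simp add: group_ring_mult distrib_right sum.distrib fun_eq_iff)
qed

end

section \<open>Modules attached to an action of a finite abelian group\<close>

locale finite_abelian_action = finite_comm_group G + group_action G S \<phi>
  for G :: "('a, 'm) monoid_scheme" (structure) and S :: "'b set" and \<phi>
begin

lemma action_closed [simp]: "g \<in> carrier G \<Longrightarrow> x \<in> S \<Longrightarrow> \<phi> g x \<in> S"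
  by (rule element_image[OF _ _ refl])

lemma action_one [simp]: "x \<in> S \<Longrightarrow> \<phi> \<one> x = x"
  using id_eq_one by (metis restrict_apply')

lemma action_inv_action [simp]: "g \<in> carrier G \<Longrightarrow> x \<in> S \<Longrightarrow> \<phi> (inv g) (\<phi> g x) = x"
  by (rule orbit_sym_aux[OF _ _ refl])

lemma action_action_inv [simp]: "g \<in> carrier G \<Longrightarrow> x \<in> S \<Longrightarrow> \<phi> g (\<phi> (inv g) x) = x"
  using action_inv_action[of "inv g" x] by simp

text \<open>As in \<open>group_ring_mult\<close>, a pair (g, y) with g y = x is determined by
  g.\<close>

lemma permutation_module_smult:
  "a \<odot>\<^bsub>permutation_module G S \<phi>\<^esub> f =
     (\<lambda>x. if x \<in> S then \<Sum>g\<in>carrier G. a g * f (\<phi> (inv g) x) else 0)"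
proof
  fix x
  let ?A = "{(g, y). g \<in> carrier G \<and> y \<in> S \<and> \<phi> g y = x}"
  have eq: "(a \<odot>\<^bsub>permutation_module G S \<phi>\<^esub> f) x = (\<Sum>(g, y)\<in>?A. a g * f y)"
    by (simp add: permutation_module_def)
  show "(a \<odot>\<^bsub>permutation_module G S \<phi>\<^esub> f) x
      = (if x \<in> S then \<Sum>g\<in>carrier G. a g * f (\<phi> (inv g) x) else 0)"
  proof (cases "x \<in> S")
    case True
    have "(\<Sum>(g, y)\<in>?A. a g * f y) = (\<Sum>g\<in>carrier G. a g * f (\<phi> (inv g) x))"
      by (rule sum.reindex_bij_witness[of _ "\<lambda>g. (g, \<phi> (inv g) x)" fst]) (use True in auto)
    with True eq show ?thesis by simp
  next
    case False
    then have "?A = {}" by auto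
    with False eq show ?thesis by simp
  qed
qed

lemma module_permutation_module: "Module.module (group_ring G) (permutation_module G S \<phi>)"
proof (rule moduleI)
  let ?R = "group_ring G" and ?M = "permutation_module G S \<phi>"
  show "cring ?R"
    by (rule cring_group_ring)
  show "abelian_group ?M"
    by (rule abelian_group_permutation_module)
  fix a b f
  assume "a \<in> carrier ?R" "b \<in> carrier ?R" and f: "f \<in> carrier ?M"
  show "(a \<otimes>\<^bsub>?R\<^esub> b) \<odot>\<^bsub>?M\<^esub> f = a \<odot>\<^bsub>?M\<^esub> (b \<odot>\<^bsub>?M\<^esub> f)"
  proof
    fix x
    show "((a \<otimes>\<^bsub>?R\<^esub> b) \<odot>\<^bsub>?M\<^esub> f) x = (a \<odot>\<^bsub>?M\<^esub> (b \<odot>\<^bsub>?M\<^esub> f)) x"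
    proof (cases "x \<in> S")
      case True
      have "((a \<otimes>\<^bsub>?R\<^esub> b) \<odot>\<^bsub>?M\<^esub> f) x
          = (\<Sum>g\<in>carrier G. \<Sum>h\<in>carrier G. a h * b (inv h \<otimes> g) * f (\<phi> (inv g) x))"
        using True by (simp add: group_ring_mult permutation_module_smult sum_distrib_right)
      also have "\<dots> = (\<Sum>h\<in>carrier G. \<Sum>g\<in>carrier G. a h * b (inv h \<otimes> g) * f (\<phi> (inv g) x))"
        by (rule sum.swap)
      also have "\<dots> = (\<Sum>h\<in>carrier G. \<Sum>g\<in>carrier G.
          a h * b (inv h \<otimes> (h \<otimes> g)) * f (\<phi> (inv (h \<otimes> g)) x))"
        by (rule sum.cong[OF refl], rule sum_mult_left)
      also have "\<dots> = (\<Sum>h\<in>carrier G. \<Sum>g\<in>carrier G. a h * (b g * f (\<phi> (inv g) (\<phi> (inv h) x))))"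
        using True
        by (intro sum.cong refl) (simp add: m_assoc[symmetric] inv_mult_group composition_rule)
      also have "\<dots> = (a \<odot>\<^bsub>?M\<^esub> (b \<odot>\<^bsub>?M\<^esub> f)) x"
        using True by (simp add: permutation_module_smult sum_distrib_left)
      finally show ?thesis .
    qed (simp add: permutation_module_smult)
  qed
next
  fix f assume f: "f \<in> carrier (permutation_module G S \<phi>)"
  have "(\<Sum>g\<in>carrier G. (if g = \<one> then 1 else 0) * f (\<phi> (inv g) x)) = f x" if "x \<in> S" for x
    using that by (simp add: if_distrib[of "\<lambda>c. c * _"] sum.delta cong: if_cong)
  then show "\<one>\<^bsub>group_ring G\<^esub> \<odot>\<^bsub>permutation_module G S \<phi>\<^esub> f = f"
    using f by (auto simp: permutation_module_smult)
qed (simp_all add: permutation_module_smult distrib_right distrib_left sum.distrib fun_eq_iff)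

section \<open>Orbit forms and their values\<close>

definition orbit_form :: "'b \<Rightarrow> ('b \<Rightarrow> complex) \<Rightarrow> 'a \<Rightarrow> complex" where
  "orbit_form y f = (\<lambda>g. if g \<in> carrier G then f (\<phi> g y) / of_nat (card (stabilizer G \<phi> y)) else 0)"

text \<open>The value of \<open>a f\<close> at g y is the sum over h of a(h) f(h^-1 g y), which is
  the convolution of a with the function sending g to f(g y).\<close>

lemma linear_form_orbit_form:
  assumes "y \<in> S"
  shows "linear_form (group_ring G) (permutation_module G S \<phi>) (orbit_form y)"
  unfolding linear_form_def
proof (intro conjI ballI)
  fix a :: "'a \<Rightarrow> complex" and f :: "'b \<Rightarrow> complex"
  show "orbit_form y (a \<odot>\<^bsub>permutation_module G S \<phi>\<^esub> f) = a \<otimes>\<^bsub>group_ring G\<^esub> orbit_form y f"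
    using assms
    by (auto simp: orbit_form_def permutation_module_smult group_ring_mult composition_rule
        sum_divide_distrib intro!: ext sum.cong)
qed (auto simp: orbit_form_def add_divide_distrib)

text \<open>If x = h y, the elements carrying y to x form the coset of the stabilizer of y by
  h.\<close>

lemma card_transporter:
  assumes "y \<in> S" "x \<in> orbit G \<phi> y"
  shows "card {g \<in> carrier G. \<phi> g y = x} = card (stabilizer G \<phi> y)"
proof -
  obtain h where h: "h \<in> carrier G" "x = \<phi> h y"
    using assms(2) by (auto simp: orbit_def)
  have "bij_betw (\<lambda>g. h \<otimes> g) (stabilizer G \<phi> y) {g \<in> carrier G. \<phi> g y = x}"
    by (rule bij_betw_byWitness[where f' = "\<lambda>g. inv h \<otimes> g"])
      (use h assms(1) in \<open>auto simp: stabilizer_def composition_rule m_assoc[symmetric]\<close>)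
  then show ?thesis
    by (simp add: bij_betw_same_card)
qed

lemma card_stabilizer_pos:
  assumes "y \<in> S"
  shows "card (stabilizer G \<phi> y) > 0"
proof -
  have "\<one> \<in> stabilizer G \<phi> y" "finite (stabilizer G \<phi> y)"
    using assms by (auto simp: stabilizer_def)
  then show ?thesis by (auto simp: card_gt_0_iff)
qed

text \<open>The coefficient at x collects f(x) / |G_y| once for each g with g y = x. There are |G_y|
  such g if x lies in the orbit of y and none otherwise, so the denominator in
  \<open>orbit_form\<close> is exactly what makes the product the restriction of f to the
  orbit.\<close>

lemma orbit_form_smult_point:
  assumes y: "y \<in> S"
  shows "orbit_form y f \<odot>\<^bsub>permutation_module G S \<phi>\<^esub> (\<lambda>x. of_bool (x = y))
    = (\<lambda>x. if x \<in> orbit G \<phi> y then f x else 0)"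
proof
  fix x
  have orb: "orbit G \<phi> y \<subseteq> S"
    using y by (auto simp: orbit_def)
  show "(orbit_form y f \<odot>\<^bsub>permutation_module G S \<phi>\<^esub> (\<lambda>x. of_bool (x = y))) x
    = (if x \<in> orbit G \<phi> y then f x else 0)"
  proof (cases "x \<in> S")
    case True
    let ?T = "{g \<in> carrier G. \<phi> g y = x}"
    have "(orbit_form y f \<odot>\<^bsub>permutation_module G S \<phi>\<^esub> (\<lambda>x. of_bool (x = y))) x
        = (\<Sum>g\<in>carrier G. orbit_form y f g * of_bool (\<phi> (inv g) x = y))"
      using True by (simp add: permutation_module_smult)
    also have "\<dots> = (\<Sum>g\<in>carrier G. if \<phi> g y = x then f x / of_nat (card (stabilizer G \<phi> y)) else 0)"
      using True y by (intro sum.cong) (auto simp: orbit_form_def)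
    also have "\<dots> = (\<Sum>g\<in>?T. f x / of_nat (card (stabilizer G \<phi> y)))"
      by (rule sum.inter_filter[symmetric]) simp
    also have "\<dots> = (if x \<in> orbit G \<phi> y then f x else 0)"
    proof (cases "x \<in> orbit G \<phi> y")
      case True
      then show ?thesis
        using card_transporter[OF y] card_stabilizer_pos[OF y] by simp
    next
      case False
      then have "?T = {}" by (auto simp: orbit_def)
      then show ?thesis using False by simp
    qed
    finally show ?thesis .
  qed (use orb in \<open>auto simp: permutation_module_smult\<close>)
qed

text \<open>The indicator of y is nonzero at g y precisely when g fixes y.\<close>

lemma orbit_form_self:
  assumes "y \<in> S"
  shows "orbit_form y (\<lambda>x. of_bool (x = y)) = subgroup_idempotent (stabilizer G \<phi> y)"
  by (auto simp: orbit_form_def subgroup_idempotent_def stabilizer_def)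

lemma orbit_eq:
  assumes "y \<in> S" "x \<in> orbit G \<phi> y"
  shows "orbit G \<phi> x = orbit G \<phi> y"
proof -
  have "x \<in> S"
    using assms by (auto simp: orbit_def)
  moreover have "z \<in> S" if "z \<in> orbit G \<phi> x \<or> z \<in> orbit G \<phi> y" for z
    using that assms(1) \<open>x \<in> S\<close> by (auto simp: orbit_def)
  ultimately show ?thesis
    using assms orbit_trans orbit_sym by blast
qed

lemma orbit_rep:
  assumes "s \<in> orbits G S \<phi>"
  shows "(SOME y. y \<in> s) \<in> S" "(SOME y. y \<in> s) \<in> s" "orbit G \<phi> (SOME y. y \<in> s) = s"
proof -
  obtain y where y: "y \<in> S" "s = orbit G \<phi> y"
    using assms by (auto simp: orbits_def)
  then have "y \<in> s"
    using orbit_refl by blast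
  then show *: "(SOME y. y \<in> s) \<in> s"
    by (rule someI)
  then show "orbit G \<phi> (SOME y. y \<in> s) = s"
    using orbit_eq y by blast
  show "(SOME y. y \<in> s) \<in> S"
    using * y by (auto simp: orbit_def)
qed

lemma mem_orbits_iff:
  assumes "s \<in> orbits G S \<phi>" "x \<in> S"
  shows "x \<in> s \<longleftrightarrow> s = orbit G \<phi> x"
proof -
  obtain y where "y \<in> S" "s = orbit G \<phi> y"
    using assms(1) by (auto simp: orbits_def)
  then show ?thesis
    using orbit_eq[of y x] orbit_refl[OF assms(2)] by metis
qed

lemma finite_orbits: "finite S \<Longrightarrow> finite (orbits G S \<phi>)"
  by (simp add: orbits_def setcompr_eq_image)

text \<open>Orbits partition S, so at most one summand survives. With P the set of all orbits this
  recovers F on S; with P an orientation it keeps F on the edges whose orbit lies in P.\<close>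

lemma sum_orbit_restrictions:
  assumes "finite S" "P \<subseteq> orbits G S \<phi>" "x \<in> S"
  shows "(\<Sum>s\<in>P. if x \<in> s then F x else 0) = (if orbit G \<phi> x \<in> P then F x else (0::complex))"
proof -
  have "finite P"
    using assms finite_orbits finite_subset by blast
  moreover have "(\<Sum>s\<in>P. if x \<in> s then F x else 0) = (\<Sum>s\<in>P. if s = orbit G \<phi> x then F x else 0)"
    using assms by (intro sum.cong) (auto simp: mem_orbits_iff)
  ultimately show ?thesis
    by simp
qed

lemma group_ring_nontrivial: "\<one>\<^bsub>group_ring G\<^esub> \<noteq> \<zero>\<^bsub>group_ring G\<^esub>"
  by (auto simp: fun_eq_iff)

lemma subgroup_idempotent_closed:
  assumes "s \<in> orbits G S \<phi>"
  shows "subgroup_idempotent (orbit_stabilizer G \<phi> s) \<in> carrier (group_ring G)"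
proof -
  obtain y where "y \<in> S" "s = orbit G \<phi> y"
    using assms by (auto simp: orbits_def)
  then show ?thesis
    by (auto simp: orbit_stabilizer_eq[OF comm_group_axioms] subgroup_idempotent_def stabilizer_def)
qed

text \<open>The expansion of f in the dual basis built from the orbit forms is its decomposition
  into restrictions to the orbits.\<close>

theorem module_rank_permutation_module:
  assumes fin: "finite S"
  shows "module_rank (group_ring G) (permutation_module G S \<phi>)
    = (\<Oplus>\<^bsub>group_ring G\<^esub>s\<in>orbits G S \<phi>. subgroup_idempotent (orbit_stabilizer G \<phi> s))"
proof -
  let ?R = "group_ring G" and ?M = "permutation_module G S \<phi>" and ?O = "orbits G S \<phi>"
  interpret M: module ?R ?M by (rule module_permutation_module)
  \<comment> \<open>Any choice of representatives will do: the stabilizer is constant along an orbit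
    as G is abelian.\<close>
  define r where "r s = (SOME y. y \<in> s)" for s :: "'b set"
  have r: "r s \<in> S" "orbit G \<phi> (r s) = s" if "s \<in> ?O" for s
    using orbit_rep[OF that] by (simp_all add: r_def)
  define x where "x s = (\<lambda>z. of_bool (z = r s) :: complex)" for s
  have "dual_basis ?R ?M ?O x (\<lambda>s. orbit_form (r s))"
    unfolding dual_basis_def
  proof (intro conjI ballI)
    fix f assume f: "f \<in> carrier ?M"
    have sm: "orbit_form (r s) f \<odot>\<^bsub>?M\<^esub> x s = (\<lambda>z. if z \<in> s then f z else 0)" if "s \<in> ?O" for s
      unfolding x_def using orbit_form_smult_point[OF r(1)[OF that]] r(2)[OF that] by simp
    have "(\<Oplus>\<^bsub>?M\<^esub>s\<in>?O. orbit_form (r s) f \<odot>\<^bsub>?M\<^esub> x s) = (\<lambda>z. \<Sum>s\<in>?O. (orbit_form (r s) f \<odot>\<^bsub>?M\<^esub> x s) z)"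
      using fin by (intro finsum_permutation_module) (auto simp: finite_orbits permutation_module_smult)
    also have "\<dots> = (\<lambda>z. \<Sum>s\<in>?O. if z \<in> s then f z else 0)"
      by (simp add: sm)
    also have "\<dots> = f"
    proof
      \<comment> \<open>On S exactly one orbit contains z; outside S both sides vanish because f
        does.\<close>
      fix z
      show "(\<Sum>s\<in>?O. if z \<in> s then f z else 0) = f z"
        using f fin by (cases "z \<in> S") (auto simp: sum_orbit_restrictions orbits_def intro!: sum.neutral)
    qed
    finally show "f = (\<Oplus>\<^bsub>?M\<^esub>s\<in>?O. orbit_form (r s) f \<odot>\<^bsub>?M\<^esub> x s)" ..
  qed (use fin r in \<open>auto simp: finite_orbits x_def intro!: linear_form_orbit_form\<close>)
  then have "module_rank ?R ?M = (\<Oplus>\<^bsub>?R\<^esub>s\<in>?O. orbit_form (r s) (x s))"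
    by (rule M.module_rank_eq_dual_basis_trace[OF group_ring_nontrivial])
  also have "\<dots> = (\<Oplus>\<^bsub>?R\<^esub>s\<in>?O. subgroup_idempotent (orbit_stabilizer G \<phi> s))"
  proof (rule M.R.finsum_cong')
    show "orbit_form (r s) (x s) = subgroup_idempotent (orbit_stabilizer G \<phi> s)" if "s \<in> ?O" for s
      using orbit_form_self[OF r(1)[OF that]] orbit_stabilizer_eq[OF comm_group_axioms r(1)[OF that]]
        r(2)[OF that] by (simp add: x_def)
    show "(\<lambda>s. subgroup_idempotent (orbit_stabilizer G \<phi> s)) \<in> ?O \<rightarrow> carrier ?R"
      using subgroup_idempotent_closed by blast
  qed simp
  finally show ?thesis .
qed

end

section \<open>The chain modules of a graph\<close>

text \<open>Each pair consisting of an edge and its reverse contains exactly one member of P.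
  Applied to the quotient graph, this turns the size of an orientation into the number of undirected
  edges.\<close>

lemma (in serre_graph) bij_betw_orientation:
  assumes "orientation Y P"
  shows "bij_betw (\<lambda>e. {e, bar Y e}) P (undirected_edges Y)"
proof -
  have sub: "P \<subseteq> edges Y" and xor: "\<And>e. e \<in> edges Y \<Longrightarrow> (e \<in> P) \<noteq> (bar Y e \<in> P)"
    using assms by (auto simp: orientation_def)
  have "inj_on (\<lambda>e. {e, bar Y e}) P"
    using sub xor by (intro inj_onI) (metis doubleton_eq_iff subsetD)
  moreover have "{e, bar Y e} \<in> (\<lambda>e. {e, bar Y e}) ` P" if e: "e \<in> edges Y" for e
  proof (cases "e \<in> P")
    case False
    then have "bar Y e \<in> P"
      using xor[OF e] by simp
    moreover have "{e, bar Y e} = {bar Y e, bar Y (bar Y e)}"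
      using bar_bar[OF e] by auto
    ultimately show ?thesis by blast
  qed simp
  ultimately show ?thesis
    using sub by (auto simp: bij_betw_def undirected_edges_def)
qed

text \<open>The relation with coefficients c takes the value c(x) + c(bar x) at an edge x, which is
  invariant under bar. Conversely an invariant f arises from the coefficients f / 2.\<close>

lemma (in finite_serre_graph) edge_relations_eq:
  "edge_relations Y = {f. (\<forall>x. x \<notin> edges Y \<longrightarrow> f x = 0) \<and> (\<forall>x\<in>edges Y. f (bar Y x) = f x)}"
proof -
  have val: "(\<Sum>e\<in>edges Y. c e * (of_bool (x = e) + of_bool (x = bar Y e)))
      = (if x \<in> edges Y then c x + c (bar Y x) else 0)" for c :: "'b \<Rightarrow> complex" and x
  proof -
    have "(\<Sum>e\<in>edges Y. c e * (of_bool (x = e) + of_bool (x = bar Y e)))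
        = (\<Sum>e\<in>edges Y. if x = e then c e else 0) + (\<Sum>e\<in>edges Y. if x = bar Y e then c e else 0)"
      unfolding sum.distrib[symmetric] by (intro sum.cong) auto
    also have "(\<Sum>e\<in>edges Y. if x = e then c e else 0) = (if x \<in> edges Y then c x else 0)"
      using finite_edges by simp
    \<comment> \<open>As bar is an involution on the edges, x = bar e means e = bar x, so again at
      most one term survives.\<close>
    also have "(\<Sum>e\<in>edges Y. if x = bar Y e then c e else 0)
        = (\<Sum>e\<in>edges Y. if e = bar Y x then if x \<in> edges Y then c e else 0 else 0)"
      using bar_closed by (intro sum.cong) (auto simp: bar_bar)
    also have "\<dots> = (if x \<in> edges Y then c (bar Y x) else 0)"
      using finite_edges bar_closed by simp
    finally show ?thesis by simp
  qed
  show ?thesis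
  proof (intro equalityI subsetI)
    fix f assume "f \<in> edge_relations Y"
    then show "f \<in> {f. (\<forall>x. x \<notin> edges Y \<longrightarrow> f x = 0) \<and> (\<forall>x\<in>edges Y. f (bar Y x) = f x)}"
      by (auto simp: edge_relations_def val bar_closed bar_bar)
  next
    fix f :: "'b \<Rightarrow> complex"
    assume f: "f \<in> {f. (\<forall>x. x \<notin> edges Y \<longrightarrow> f x = 0) \<and> (\<forall>x\<in>edges Y. f (bar Y x) = f x)}"
    then have "f = (\<lambda>x. \<Sum>e\<in>edges Y. f e / 2 * (of_bool (x = e) + of_bool (x = bar Y e)))"
      unfolding val by auto
    then show "f \<in> edge_relations Y"
      unfolding edge_relations_def by (intro CollectI exI conjI TrueI)
  qed
qed

locale finite_abelian_graph_action =
  graph_action_without_inversion G Y \<phi> \<psi> + finite_serre_graph Y + finite_comm_group G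
  for G :: "('g, 'm) monoid_scheme" (structure)
    and Y :: "('v, 'e) sgraph" and \<phi> and \<psi>
begin

sublocale VA: finite_abelian_action G "verts Y" \<phi> ..

sublocale EA: finite_abelian_action G "edges Y" \<psi> ..

abbreviation edge_module :: "('g \<Rightarrow> complex, 'e \<Rightarrow> complex) module" where
  "edge_module \<equiv> permutation_module G (edges Y) \<psi>"

text \<open>Invariance under bar passes from f to its multiples by group ring elements because bar
  commutes with the action.\<close>

lemma submodule_edge_relations: "submodule (edge_relations Y) (group_ring G) edge_module"
proof -
  interpret M: module "group_ring G" edge_module
    by (rule EA.module_permutation_module)
  have smult: "a \<odot>\<^bsub>edge_module\<^esub> f \<in> edge_relations Y" if "f \<in> edge_relations Y" for a f
    using that bar_closed bar_act[symmetric]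
    by (auto simp: edge_relations_eq EA.permutation_module_smult intro!: sum.cong)
  show ?thesis
  proof (rule M.submoduleI)
    fix f assume f: "f \<in> edge_relations Y"
    then have "f \<in> carrier edge_module"
      by (simp add: edge_relations_eq)
    then have "\<ominus>\<^bsub>edge_module\<^esub> f = (\<ominus>\<^bsub>group_ring G\<^esub> \<one>\<^bsub>group_ring G\<^esub>) \<odot>\<^bsub>edge_module\<^esub> f"
      by (simp add: M.smult_l_minus del: group_ring_sel permutation_module_sel)
    with smult[OF f] show "\<ominus>\<^bsub>edge_module\<^esub> f \<in> edge_relations Y"
      by simp
  qed (auto simp: smult, auto simp: edge_relations_eq)
qed

sublocale C1: module_with_submodule "group_ring G" edge_module "edge_relations Y"
  using EA.module_permutation_module submodule_edge_relations
  by (intro module_with_submodule.intro module_with_submodule_axioms.intro)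

text \<open>On chains its kernel is the module of relations, so forms that factor through it descend
  to C_1(Y). There is no factor 1/2, since only one edge of each pair x, bar x will be summed
  over.\<close>

definition antisymmetrize :: "('e \<Rightarrow> complex) \<Rightarrow> 'e \<Rightarrow> complex" where
  "antisymmetrize f = (\<lambda>x. if x \<in> edges Y then f x - f (bar Y x) else 0)"

text \<open>As bar commutes with the action, antisymmetrization is linear over the group ring, and
  it is followed by an orbit form.\<close>

lemma linear_form_antisymmetrize:
  assumes "e \<in> edges Y"
  shows "linear_form (group_ring G) edge_module (\<lambda>f. EA.orbit_form e (antisymmetrize f))"
proof -
  note lf = EA.linear_form_orbit_form[OF assms]
  have closed: "antisymmetrize f \<in> carrier edge_module" for f
    by (simp add: antisymmetrize_def)
  have "antisymmetrize (f \<oplus>\<^bsub>edge_module\<^esub> f') = antisymmetrize f \<oplus>\<^bsub>edge_module\<^esub> antisymmetrize f'" for f f'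
    by (auto simp: antisymmetrize_def)
  moreover have "antisymmetrize (a \<odot>\<^bsub>edge_module\<^esub> f) = a \<odot>\<^bsub>edge_module\<^esub> antisymmetrize f" for a f
    by (auto simp: antisymmetrize_def EA.permutation_module_smult bar_closed bar_act[symmetric]
        sum_subtractf[symmetric] right_diff_distrib intro!: ext sum.cong)
  ultimately show ?thesis
    using linear_formD[OF lf] closed
    by (auto simp: linear_form_def simp del: permutation_module_sel group_ring_sel)
qed

theorem module_rank_chain1:
  assumes P: "orientation (quotient_graph G Y \<phi> \<psi>) P"
  shows "module_rank (group_ring G) (chain1 G Y \<psi>)
    = (\<Oplus>\<^bsub>group_ring G\<^esub>s\<in>P. subgroup_idempotent (orbit_stabilizer G \<psi> s))"
proof -
  let ?R = "group_ring G" and ?M = edge_module and ?W = "edge_relations Y"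
  have PO: "P \<subseteq> orbits G (edges Y) \<psi>"
    using P by (simp add: orientation_def quotient_graph_def)
  have finP: "finite P"
    using PO EA.finite_orbits[OF finite_edges] finite_subset by blast
  \<comment> \<open>The orientation condition on the quotient, pulled back to an edge x of
    Y.\<close>
  have xor: "(orbit G \<psi> x \<in> P) \<noteq> (orbit G \<psi> (bar Y x) \<in> P)" if "x \<in> edges Y" for x
    using P that by (auto simp: orientation_def quotient_graph_def orbits_def image_orbit(3)[symmetric])
  define r where "r s = (SOME y. y \<in> s)" for s :: "'e set"
  have r: "r s \<in> edges Y" "orbit G \<psi> (r s) = s" if "s \<in> P" for s
    using EA.orbit_rep[of s] PO that by (auto simp: r_def)
  define x where "x s = (\<lambda>z. of_bool (z = r s) :: complex)" for s
  define l where "l s f = EA.orbit_form (r s) (antisymmetrize f)" for s f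
  have x: "x s \<in> carrier ?M" if "s \<in> P" for s
    using r(1)[OF that] by (auto simp: x_def)
  have l: "linear_form ?R ?M (l s)" if "s \<in> P" for s
    using linear_form_antisymmetrize[OF r(1)[OF that]] by (simp add: l_def[abs_def])
  have l0: "l s w = \<zero>\<^bsub>?R\<^esub>" if "s \<in> P" "w \<in> ?W" for s w
  proof -
    have "antisymmetrize w = (\<lambda>x. 0)"
      using that(2) by (auto simp: antisymmetrize_def edge_relations_eq)
    then show ?thesis
      by (simp add: l_def EA.orbit_form_def fun_eq_iff)
  qed
  have sum: "f \<in> ?W +>\<^bsub>?M\<^esub> (\<Oplus>\<^bsub>?M\<^esub>s\<in>P. l s f \<odot>\<^bsub>?M\<^esub> x s)" if f: "f \<in> carrier ?M" for f
  proof -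
    have sm: "l s f \<odot>\<^bsub>?M\<^esub> x s = (\<lambda>z. if z \<in> s then antisymmetrize f z else 0)" if "s \<in> P" for s
      unfolding x_def l_def using EA.orbit_form_smult_point[OF r(1)[OF that]] r(2)[OF that] by simp
    \<comment> \<open>F is the antisymmetrization of f cut off to the edges whose orbit lies in P;
      the claim is that it represents the same class as f.\<close>
    define F where "F = (\<Oplus>\<^bsub>?M\<^esub>s\<in>P. l s f \<odot>\<^bsub>?M\<^esub> x s)"
    have "F = (\<lambda>z. \<Sum>s\<in>P. (l s f \<odot>\<^bsub>?M\<^esub> x s) z)"
      unfolding F_def using finP
      by (intro finsum_permutation_module) (auto simp: EA.permutation_module_smult)
    then have Fz: "F z = (\<Sum>s\<in>P. if z \<in> s then antisymmetrize f z else 0)" for z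
      by (simp add: sm)
    have F: "F z = (if orbit G \<psi> z \<in> P then antisymmetrize f z else 0)" if "z \<in> edges Y" for z
      unfolding Fz by (rule EA.sum_orbit_restrictions[OF finite_edges PO that])
    have F0: "F z = 0" if "z \<notin> edges Y" for z
      unfolding Fz using that by (intro sum.neutral) (simp add: antisymmetrize_def)
    \<comment> \<open>Exactly one of z and bar z has its orbit in P. At both of them f - F takes the
      value of f at the other one, the edge whose orbit is not in P.\<close>
    have "f (bar Y z) - F (bar Y z) = f z - F z" if z: "z \<in> edges Y" for z
      using xor[OF z] z bar_closed[OF z] bar_bar[OF z]
      by (cases "orbit G \<psi> z \<in> P") (simp_all add: F antisymmetrize_def)
    then have "(\<lambda>z. f z - F z) \<in> ?W"
      using f by (simp add: edge_relations_eq F0)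
    moreover have "f = (\<lambda>z. f z - F z) \<oplus>\<^bsub>?M\<^esub> F"
      by simp
    ultimately show ?thesis
      unfolding F_def[symmetric] a_r_coset_def' by blast
  qed
  obtain k where k: "dual_basis ?R (quotient_module ?M ?W) P (\<lambda>s. ?W +>\<^bsub>?M\<^esub> x s) k"
    and kl: "\<And>s f. s \<in> P \<Longrightarrow> f \<in> carrier ?M \<Longrightarrow> k s (?W +>\<^bsub>?M\<^esub> f) = l s f"
    using C1.dual_basis_quotient[OF finP x l l0 sum] by metis
  interpret Q: module ?R "quotient_module ?M ?W"
    by (rule C1.module_quotient)
  have "module_rank ?R (chain1 G Y \<psi>) = (\<Oplus>\<^bsub>?R\<^esub>s\<in>P. k s (?W +>\<^bsub>?M\<^esub> x s))"
    unfolding chain1_def by (rule Q.module_rank_eq_dual_basis_trace[OF EA.group_ring_nontrivial k])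
  also have "\<dots> = (\<Oplus>\<^bsub>?R\<^esub>s\<in>P. subgroup_idempotent (orbit_stabilizer G \<psi> s))"
  proof (rule C1.R.finsum_cong')
    fix s assume s: "s \<in> P"
    have "EA.orbit_form (r s) (antisymmetrize (x s)) = EA.orbit_form (r s) (x s)"
    proof -
      \<comment> \<open>Without inversions the reverse of g (r s) is never r s, so the subtracted
        term is zero and the value is that of the plain orbit form.\<close>
      have "antisymmetrize (x s) (\<psi> g (r s)) = x s (\<psi> g (r s))" if g: "g \<in> carrier G" for g
      proof -
        have "bar Y (\<psi> g (r s)) \<noteq> r s"
          using no_inversion[OF g r(1)[OF s]] bar_bar[OF EA.action_closed[OF g r(1)[OF s]]] by metis
        then show ?thesis
          using r(1)[OF s] g by (simp add: antisymmetrize_def x_def)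
      qed
      then show ?thesis
        by (auto simp: EA.orbit_form_def)
    qed
    then show "k s (?W +>\<^bsub>?M\<^esub> x s) = subgroup_idempotent (orbit_stabilizer G \<psi> s)"
      using kl[OF s x[OF s]] EA.orbit_form_self[OF r(1)[OF s]]
        E.orbit_stabilizer_eq[OF comm_group_axioms r(1)[OF s]] r(2)[OF s]
      by (simp add: l_def x_def)
  next
    show "(\<lambda>s. subgroup_idempotent (orbit_stabilizer G \<psi> s)) \<in> P \<rightarrow> carrier ?R"
      using EA.subgroup_idempotent_closed PO by blast
  qed simp
  finally show ?thesis .
qed

end

section \<open>The equivariant Euler characteristic\<close>

theorem theorem4p2:
  fixes G :: "('g, 'm) monoid_scheme"
    and Y :: "('v, 'e) sgraph"
    and \<phi> :: "'g \<Rightarrow> 'v \<Rightarrow> 'v"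
    and \<psi> :: "'g \<Rightarrow> 'e \<Rightarrow> 'e"
    and X :: "('v set, 'e set) sgraph"
    and P :: "'e set set"
  assumes "comm_group G"
    and "finite (carrier G)"
    and "finite_serre_graph Y"
    and "graph_action_without_inversion G Y \<phi> \<psi>"
    and "X = quotient_graph G Y \<phi> \<psi>"
    and "orientation X P"
  shows "equivariant_euler_char G Y \<phi> \<psi> =
           (\<Oplus>\<^bsub>group_ring G\<^esub>v\<in>verts X. subgroup_idempotent (orbit_stabilizer G \<phi> v))
             \<ominus>\<^bsub>group_ring G\<^esub>
           (\<Oplus>\<^bsub>group_ring G\<^esub>s\<in>P. subgroup_idempotent (orbit_stabilizer G \<psi> s))
       \<and> (acts_freely_on G \<psi> (edges Y) \<longrightarrow>
          equivariant_euler_char G Y \<phi> \<psi> =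
           (\<Oplus>\<^bsub>group_ring G\<^esub>v\<in>verts X. subgroup_idempotent (orbit_stabilizer G \<phi> v))
             \<ominus>\<^bsub>group_ring G\<^esub>
           [card (undirected_edges X)] \<cdot>\<^bsub>group_ring G\<^esub> \<one>\<^bsub>group_ring G\<^esub>)"
proof -
  interpret A: finite_abelian_graph_action G Y \<phi> \<psi>
    using assms(1-4)
    by (simp add: finite_abelian_graph_action_def finite_comm_group_def finite_comm_group_axioms_def)
  have verts: "verts X = orbits G (verts Y) \<phi>"
    using assms(5) by (simp add: quotient_graph_def)
  have PO: "P \<subseteq> orbits G (edges Y) \<psi>"
    using assms(5,6) by (simp add: orientation_def quotient_graph_def)
  have main: "equivariant_euler_char G Y \<phi> \<psi> =
      (\<Oplus>\<^bsub>group_ring G\<^esub>v\<in>verts X. subgroup_idempotent (orbit_stabilizer G \<phi> v))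
        \<ominus>\<^bsub>group_ring G\<^esub>
      (\<Oplus>\<^bsub>group_ring G\<^esub>s\<in>P. subgroup_idempotent (orbit_stabilizer G \<psi> s))"
    unfolding equivariant_euler_char_def chain0_def verts
    using A.module_rank_chain1 A.VA.module_rank_permutation_module[OF A.finite_verts] assms(5,6)
    by simp
  have "(\<Oplus>\<^bsub>group_ring G\<^esub>s\<in>P. subgroup_idempotent (orbit_stabilizer G \<psi> s))
      = [card (undirected_edges X)] \<cdot>\<^bsub>group_ring G\<^esub> \<one>\<^bsub>group_ring G\<^esub>"
    if free: "acts_freely_on G \<psi> (edges Y)"
  proof -
    \<comment> \<open>For a free action all edge stabilizers are trivial, and the idempotent of the
      trivial subgroup is the unit of the group ring.\<close>
    have "subgroup_idempotent (orbit_stabilizer G \<psi> s) = \<one>\<^bsub>group_ring G\<^esub>" if "s \<in> P" for s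
    proof -
      obtain e where e: "e \<in> edges Y" "s = orbit G \<psi> e"
        using \<open>s \<in> P\<close> PO by (auto simp: orbits_def)
      have "stabilizer G \<psi> e = {\<one>\<^bsub>G\<^esub>}"
        using free e(1) by (auto simp: acts_freely_on_def stabilizer_def)
      then have "orbit_stabilizer G \<psi> s = {\<one>\<^bsub>G\<^esub>}"
        using A.E.orbit_stabilizer_eq[OF assms(1) e(1)] e(2) by simp
      then show ?thesis
        by (simp add: subgroup_idempotent_def fun_eq_iff)
    qed
    then have "(\<Oplus>\<^bsub>group_ring G\<^esub>s\<in>P. subgroup_idempotent (orbit_stabilizer G \<psi> s))
        = (\<Oplus>\<^bsub>group_ring G\<^esub>s\<in>P. \<one>\<^bsub>group_ring G\<^esub>)"
      by (intro A.C1.R.finsum_cong') auto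
    also have "\<dots> = [card P] \<cdot>\<^bsub>group_ring G\<^esub> \<one>\<^bsub>group_ring G\<^esub>"
      by (rule A.C1.R.add.finprod_const) simp
    \<comment> \<open>The quotient is again a Serre graph, as there are no inversions, so P contains
      one member of each undirected edge of X.\<close>
    also have "card P = card (undirected_edges X)"
      using serre_graph.bij_betw_orientation[OF A.serre_graph_quotient] assms(5,6)
        bij_betw_same_card by blast
    finally show ?thesis .
  qed
  with main show ?thesis
    by simp
qed

end
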